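(* Let $Z_k(\tau)$ be any nontrivial deformation of $Z_k$. Then $Z_k(\tau)$ admits the structure of a smooth affine algebraic variety.
   Context: For an integer $k \geq 1$, $Z_k = \operatorname{Tot}(\mathcal O_{\mathbb P^1}(-k))$ is covered by two charts $U = \mathbb C^2_{z,u}$ and $V = \mathbb C^2_{\xi,v}$ with $U \cap V \simeq \mathbb C^* \times \mathbb C$ and $(\xi, v) = (z^{-1}, z^k u)$. For $(t_1,\dots,t_{k-1}) \in \mathbb C^{k-1}$ let $\tau \in H^1(Z_k, \mathcal T_{Z_k})$ be the class of the 1-cocycle $\sum_{i=1}^{k-1} t_i z^{-k+i}\frac{\partial}{\partial u}$ (in $U$-coordinates); this gives an isomorphism $\mathbb C^{k-1} \simeq H^1(Z_k, \mathcal T_{Z_k})$. The deformation $Z_k(\tau)$ is the complex surface obtained by gluing $U = \mathbb C^2_{z,u}$ and $V = \mathbb C^2_{\xi,v}$ along $U \cap V \simeq \mathbb C^* \times \mathbb C$ by $$(\xi, v) = \Big(z^{-1},\ z^k u + \sum_{i=1}^{k-1} t_i z^i\Big).$$ Only deformations of $Z_k$ of this form are considered. The deformation $Z_k(\tau)$ is called nontrivial if $\tau \neq 0$, i.e. if $(t_1,\dots,t_{k-1}) \neq 0$ (in particular $k \geq 2$). Varieties are over $\mathbb C$. *)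

theory Defs
  imports "HOL-Complex_Analysis.Complex_Analysis" "HOL-Library.Poly_Mapping"
begin

section \<open>Complex spaces and biholomorphic maps\<close>

text \<open>
  A complex space is given by its topology and its structure sheaf: for an open set \<open>W\<close>, the set
  \<open>Hol X W\<close> consists of the functions that are holomorphic on \<open>W\<close>. Functions are total in HOL; all
  structure sheaves below depend only on the values on \<open>W\<close>, and \<open>Hol X W\<close> is only meaningful for
  \<open>W\<close> open in \<open>X\<close>.
\<close>

record 'a complex_space =
  Top :: "'a topology"
  Hol :: "'a set \<Rightarrow> ('a \<Rightarrow> complex) set"

definition holomorphic_map :: "'a complex_space \<Rightarrow> 'b complex_space \<Rightarrow> ('a \<Rightarrow> 'b) \<Rightarrow> bool" where
  "holomorphic_map X Y \<phi> \<longleftrightarrow>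
     continuous_map (Top X) (Top Y) \<phi> \<and>
     (\<forall>W f. openin (Top Y) W \<and> f \<in> Hol Y W
        \<longrightarrow> f \<circ> \<phi> \<in> Hol X {x \<in> topspace (Top X). \<phi> x \<in> W})"

definition biholomorphic :: "'a complex_space \<Rightarrow> 'b complex_space \<Rightarrow> bool" where
  "biholomorphic X Y \<longleftrightarrow>
     (\<exists>\<phi> \<psi>. holomorphic_map X Y \<phi> \<and> holomorphic_map Y X \<psi> \<and>
        (\<forall>x\<in>topspace (Top X). \<psi> (\<phi> x) = x) \<and> (\<forall>y\<in>topspace (Top Y). \<phi> (\<psi> y) = y))"

section \<open>The deformations of the total space of a line bundle on the projective line\<close>

text \<open>Holomorphic functions of several variables are the functions that are continuous and
  holomorphic in each variable separately (Osgood).\<close>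

definition hol_C2 :: "(complex \<times> complex) set \<Rightarrow> (complex \<times> complex \<Rightarrow> complex) set" where
  "hol_C2 S = {f. continuous_on S f \<and>
     (\<forall>b. (\<lambda>a. f (a, b)) holomorphic_on {a. (a, b) \<in> S}) \<and>
     (\<forall>a. (\<lambda>b. f (a, b)) holomorphic_on {b. (a, b) \<in> S})}"

text \<open>The points of \<open>Inl\<close> form the chart \<open>U\<close> with coordinates \<open>(z, u)\<close>, those of \<open>Inr\<close> the chart
  \<open>V\<close> with coordinates \<open>(\<xi>, v)\<close>.\<close>

type_synonym glue_pt = "(complex \<times> complex) + (complex \<times> complex)"

definition transition :: "nat \<Rightarrow> (nat \<Rightarrow> complex) \<Rightarrow> complex \<times> complex \<Rightarrow> complex \<times> complex" where
  "transition k t = (\<lambda>(z, u). (inverse z, z ^ k * u + (\<Sum>i=1..k-1. t i * z ^ i)))"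

definition glue_step :: "nat \<Rightarrow> (nat \<Rightarrow> complex) \<Rightarrow> glue_pt rel" where
  "glue_step k t = {(Inl (z, u), Inr (transition k t (z, u))) | z u. z \<noteq> 0}"

definition glue_rel :: "nat \<Rightarrow> (nat \<Rightarrow> complex) \<Rightarrow> glue_pt rel" where
  "glue_rel k t = (glue_step k t \<union> (glue_step k t)\<inverse>)\<^sup>*"

definition Z_points :: "nat \<Rightarrow> (nat \<Rightarrow> complex) \<Rightarrow> glue_pt set set" where
  "Z_points k t = UNIV // glue_rel k t"

definition chart_U :: "nat \<Rightarrow> (nat \<Rightarrow> complex) \<Rightarrow> complex \<times> complex \<Rightarrow> glue_pt set" where
  "chart_U k t p = glue_rel k t `` {Inl p}"

definition chart_V :: "nat \<Rightarrow> (nat \<Rightarrow> complex) \<Rightarrow> complex \<times> complex \<Rightarrow> glue_pt set" where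
  "chart_V k t q = glue_rel k t `` {Inr q}"

definition Z_deform_top :: "nat \<Rightarrow> (nat \<Rightarrow> complex) \<Rightarrow> glue_pt set topology" where
  "Z_deform_top k t = topology (\<lambda>W. W \<subseteq> Z_points k t \<and> open (chart_U k t -` W) \<and> open (chart_V k t -` W))"

text \<open>The surface \<open>Z\<^sub>k(\<tau>)\<close>, where \<open>\<tau>\<close> is the class with coordinates \<open>(t 1, \<dots>, t (k - 1))\<close>; the
  other values of \<open>t\<close> are not used.\<close>

definition Z_deform :: "nat \<Rightarrow> (nat \<Rightarrow> complex) \<Rightarrow> glue_pt set complex_space" where
  "Z_deform k t = \<lparr> Top = Z_deform_top k t,
     Hol = (\<lambda>W. {f. f \<circ> chart_U k t \<in> hol_C2 (chart_U k t -` W) \<and>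
                    f \<circ> chart_V k t \<in> hol_C2 (chart_V k t -` W)}) \<rparr>"

lemma openin_Z_deform_top:
  "openin (Z_deform_top k t) W \<longleftrightarrow>
     W \<subseteq> Z_points k t \<and> open (chart_U k t -` W) \<and> open (chart_V k t -` W)"
proof -
  have "istopology (\<lambda>W. W \<subseteq> Z_points k t \<and> open (chart_U k t -` W) \<and> open (chart_V k t -` W))"
    unfolding istopology_def by (auto simp: vimage_Union intro!: open_Int open_UN)
  then show ?thesis
    unfolding Z_deform_top_def by (simp add: topology_inverse')
qed

lemma equiv_glue_rel: "equiv UNIV (glue_rel k t)"
proof -
  have "sym (glue_rel k t)"
    unfolding glue_rel_def by (intro sym_rtrancl sym_Un_converse)
  moreover have "refl (glue_rel k t)" "trans (glue_rel k t)"
    unfolding glue_rel_def by (rule refl_rtrancl, rule trans_rtrancl)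
  ultimately show ?thesis
    by (simp add: equiv_def)
qed

lemma topspace_Z_deform_top: "topspace (Z_deform_top k t) = Z_points k t"
proof -
  have "chart_U k t -` Z_points k t = UNIV" "chart_V k t -` Z_points k t = UNIV"
    by (auto simp: chart_U_def chart_V_def Z_points_def quotient_def)
  then have "openin (Z_deform_top k t) (Z_points k t)"
    by (simp add: openin_Z_deform_top)
  then show ?thesis
    by (metis openin_Z_deform_top openin_subset openin_topspace subset_antisym)
qed

section \<open>Affine algebraic varieties over the complex numbers\<close>

text \<open>Polynomials in the variables with indices \<open>0, \<dots>, N - 1\<close>: a monomial is a finitely supported
  exponent function, and a polynomial is a finitely supported function from monomials to
  coefficients (with the convolution product).\<close>

type_synonym cpoly = "(nat \<Rightarrow>\<^sub>0 nat) \<Rightarrow>\<^sub>0 complex"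

definition polys :: "nat \<Rightarrow> cpoly set" where
  "polys N = {f. \<forall>m\<in>Poly_Mapping.keys f. Poly_Mapping.keys m \<subseteq> {..<N}}"

definition poly_val :: "cpoly \<Rightarrow> (nat \<Rightarrow> complex) \<Rightarrow> complex" where
  "poly_val f x = (\<Sum>m\<in>Poly_Mapping.keys f. Poly_Mapping.lookup f m *
      (\<Prod>i\<in>Poly_Mapping.keys m. x i ^ Poly_Mapping.lookup m i))"

definition partial_deriv :: "nat \<Rightarrow> cpoly \<Rightarrow> (nat \<Rightarrow> complex) \<Rightarrow> complex" where
  "partial_deriv i f x = deriv (\<lambda>s. poly_val f (x(i := s))) (x i)"

text \<open>Points of complex \<open>N\<close>-space are functions on \<open>{..<N}\<close>, made total by \<open>undefined\<close>.\<close>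

abbreviation affine_space :: "nat \<Rightarrow> (nat \<Rightarrow> complex) set" where
  "affine_space N \<equiv> {..<N} \<rightarrow>\<^sub>E UNIV"

definition algebraic_set :: "nat \<Rightarrow> (nat \<Rightarrow> complex) set \<Rightarrow> bool" where
  "algebraic_set N X \<longleftrightarrow>
     (\<exists>F\<subseteq>polys N. X = {x \<in> affine_space N. \<forall>f\<in>F. poly_val f x = 0})"

definition vanishing_ideal :: "nat \<Rightarrow> (nat \<Rightarrow> complex) set \<Rightarrow> cpoly set" where
  "vanishing_ideal N X = {f \<in> polys N. \<forall>x\<in>X. poly_val f x = 0}"

definition affine_variety :: "nat \<Rightarrow> (nat \<Rightarrow> complex) set \<Rightarrow> bool" where
  "affine_variety N X \<longleftrightarrow> algebraic_set N X \<and> X \<noteq> {} \<and>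
     (\<forall>A B. algebraic_set N A \<and> algebraic_set N B \<and> X = A \<union> B \<longrightarrow> X = A \<or> X = B)"

text \<open>\<open>X\<close> is smooth at \<open>p\<close> if, locally at \<open>p\<close>, its ideal is generated by polynomials
  \<open>f\<^sub>0, \<dots>, f\<^sub>r\<^sub>-\<^sub>1\<close> whose Jacobian matrix at \<open>p\<close> has rank \<open>r\<close> (so that \<open>X\<close> has dimension \<open>N - r\<close>
  at \<open>p\<close>). Generation in the local ring at \<open>p\<close> is expressed by clearing denominators.\<close>

definition smooth_at :: "nat \<Rightarrow> (nat \<Rightarrow> complex) set \<Rightarrow> (nat \<Rightarrow> complex) \<Rightarrow> bool" where
  "smooth_at N X p \<longleftrightarrow>
     (\<exists>r f. (\<forall>j<r. f j \<in> vanishing_ideal N X) \<and>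
        (\<forall>g\<in>vanishing_ideal N X. \<exists>h\<in>polys N. poly_val h p \<noteq> 0 \<and>
           (\<exists>q. (\<forall>j<r. q j \<in> polys N) \<and> h * g = (\<Sum>j<r. q j * f j))) \<and>
        (\<forall>c :: nat \<Rightarrow> complex. (\<forall>i<N. (\<Sum>j<r. c j * partial_deriv i (f j) p) = 0)
           \<longrightarrow> (\<forall>j<r. c j = 0)))"

definition smooth_affine_variety :: "nat \<Rightarrow> (nat \<Rightarrow> complex) set \<Rightarrow> bool" where
  "smooth_affine_variety N X \<longleftrightarrow> affine_variety N X \<and> (\<forall>p\<in>X. smooth_at N X p)"

section \<open>The complex space underlying an affine variety\<close>

definition CN_top :: "nat \<Rightarrow> (nat \<Rightarrow> complex) topology" where
  "CN_top N = product_topology (\<lambda>_. euclidean) {..<N}"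

definition hol_CN :: "nat \<Rightarrow> (nat \<Rightarrow> complex) set \<Rightarrow> ((nat \<Rightarrow> complex) \<Rightarrow> complex) set" where
  "hol_CN N S = {f. continuous_map (subtopology (CN_top N) S) euclidean f \<and>
     (\<forall>x\<in>S. \<forall>i<N. (\<lambda>s. f (x(i := s))) holomorphic_on {s. x(i := s) \<in> S})}"

text \<open>A function on a Euclidean-open subset of \<open>X\<close> is holomorphic if it is locally the restriction
  of a holomorphic function on an open subset of the ambient space.\<close>

definition analytification :: "nat \<Rightarrow> (nat \<Rightarrow> complex) set \<Rightarrow> (nat \<Rightarrow> complex) complex_space" where
  "analytification N X = \<lparr> Top = subtopology (CN_top N) X,
     Hol = (\<lambda>W. {f. \<forall>p\<in>W. \<exists>S g. openin (CN_top N) S \<and> p \<in> S \<and> g \<in> hol_CN N S \<and>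
                        (\<forall>x\<in>S \<inter> W. f x = g x)}) \<rparr>"

end

theory Submission
  imports Defs
begin

text \<open>
  Put \<open>s j = t (k - j)\<close> for \<open>0 < j < k\<close> and \<open>s 0 = s k = 0\<close>. The class \<open>\<tau>\<close> is exactly what prevents
  \<open>v\<close> from being \<open>z ^ k * u\<close>; but starting from the global function \<open>x\<^sub>0 = u\<close> the recursion
  \<open>x\<^sub>j\<^sub>+\<^sub>1 = z * (x\<^sub>j + s j)\<close> produces functions \<open>x\<^sub>0, \<dots>, x\<^sub>k\<close> with \<open>x\<^sub>k = v\<close>, and reading it backwards,
  \<open>x\<^sub>j + s j = \<xi> * x\<^sub>j\<^sub>+\<^sub>1\<close>, shows that all of them are polynomials in \<open>(\<xi>, v)\<close> too. So they are global
  functions on the surface, and they map it to the set \<open>X\<close> of points of \<open>\<complex>\<^sup>k\<^sup>+\<^sup>1\<close> where the matrix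
  with top row \<open>x\<^sub>j + s j\<close> and bottom row \<open>x\<^sub>j\<^sub>+\<^sub>1\<close> (\<open>0 \<le> j < k\<close>) has rank at most one: a deformation of
  the cone over a rational normal curve.

  For \<open>\<tau> = 0\<close> this map contracts the zero section. For \<open>\<tau> \<noteq> 0\<close> the matrix vanishes nowhere, because
  its vanishing would force \<open>x\<^sub>j = 0\<close> for \<open>j > 0\<close> and then \<open>s j = 0\<close>. Hence at each point of \<open>X\<close> the ratio of
  the rows is a well-defined point of the projective line, where the top row is nonzero \<open>(z, u)\<close> is
  recovered as \<open>(x\<^sub>a\<^sub>+\<^sub>1 / (x\<^sub>a + s a), x\<^sub>0)\<close>, where the bottom row is nonzero \<open>(\<xi>, v)\<close> is recovered
  likewise, and the surface is biholomorphic to \<open>X\<close>.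

  The two charts are interchanged by \<open>x\<^sub>j \<mapsto> x\<^sub>k\<^sub>-\<^sub>j + s (k - j)\<close>, \<open>s j \<mapsto> - s (k - j)\<close>. Everything about one
  chart is therefore proved once, in the locale \<open>scroll\<close>, whose parameters allow for this change of
  coordinates, and is then used for both charts in the locale \<open>deformation\<close>.

  Smoothness (\<open>smooth_at_pivot\<close>): where the entry \<open>x\<^sub>a + s a\<close> is nonzero, the \<open>k - 1\<close> minors that
  involve column \<open>a\<close> generate the ideal of \<open>X\<close> locally and have independent gradients. Irreducibility
  (\<open>affine_variety_X\<close>): \<open>X\<close> has a dense subset parametrised by the plane. Holomorphy of the embedding
  needs the chain rule for functions that are only known to be continuous and separately holomorphic
  (\<open>hol_CN_comp\<close>); the coordinate formulas above give that of its inverse.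
\<close>

section \<open>Evaluation of polynomials\<close>

abbreviation mconst :: "complex \<Rightarrow> cpoly" where
  "mconst c \<equiv> Poly_Mapping.single 0 c"

definition mvar :: "nat \<Rightarrow> cpoly" where
  "mvar i = Poly_Mapping.single (Poly_Mapping.single i 1) 1"

definition mono_val :: "(nat \<Rightarrow>\<^sub>0 nat) \<Rightarrow> (nat \<Rightarrow> complex) \<Rightarrow> complex" where
  "mono_val m x = (\<Prod>i\<in>Poly_Mapping.keys m. x i ^ Poly_Mapping.lookup m i)"

lemma mono_val_superset:
  assumes "finite S" "Poly_Mapping.keys m \<subseteq> S"
  shows "mono_val m x = (\<Prod>i\<in>S. x i ^ Poly_Mapping.lookup m i)"
  unfolding mono_val_def
  by (rule prod.mono_neutral_left) (use assms in \<open>auto simp: in_keys_iff\<close>)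

lemma mono_val_add: "mono_val (m + n) x = mono_val m x * mono_val n x"
proof -
  define S where "S = Poly_Mapping.keys m \<union> Poly_Mapping.keys n"
  have S: "finite S" "Poly_Mapping.keys m \<subseteq> S" "Poly_Mapping.keys n \<subseteq> S"
      "Poly_Mapping.keys (m + n) \<subseteq> S"
    using keys_add[of m n] by (auto simp: S_def)
  show ?thesis
    by (simp add: mono_val_superset[OF S(1,2)] mono_val_superset[OF S(1,3)]
        mono_val_superset[OF S(1,4)] lookup_add power_add prod.distrib)
qed

lemma poly_val_superset:
  assumes "finite S" "Poly_Mapping.keys f \<subseteq> S"
  shows "poly_val f x = (\<Sum>m\<in>S. Poly_Mapping.lookup f m * mono_val m x)"
  unfolding poly_val_def mono_val_def
  by (rule sum.mono_neutral_left) (use assms in \<open>auto simp: in_keys_iff\<close>)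

lemma poly_val_add [simp]: "poly_val (f + g) x = poly_val f x + poly_val g x"
proof -
  define S where "S = Poly_Mapping.keys f \<union> Poly_Mapping.keys g"
  have S: "finite S" "Poly_Mapping.keys f \<subseteq> S" "Poly_Mapping.keys g \<subseteq> S"
      "Poly_Mapping.keys (f + g) \<subseteq> S"
    using keys_add[of f g] by (auto simp: S_def)
  show ?thesis
    by (simp add: poly_val_superset[OF S(1,2)] poly_val_superset[OF S(1,3)]
        poly_val_superset[OF S(1,4)] lookup_add sum.distrib algebra_simps)
qed

lemma poly_val_single: "poly_val (Poly_Mapping.single m c) x = c * mono_val m x"
  by (simp add: poly_val_superset[of "{m}"] subset_iff)

lemma poly_val_0 [simp]: "poly_val 0 x = 0"
  by (simp add: poly_val_def)

lemma poly_val_mconst [simp]: "poly_val (mconst c) x = c"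
  by (simp add: poly_val_single mono_val_def)

lemma poly_val_1 [simp]: "poly_val 1 x = 1"
  by (metis poly_val_mconst single_one)

lemma poly_val_mvar [simp]: "poly_val (mvar i) x = x i"
  by (simp add: mvar_def poly_val_single mono_val_def)

lemma poly_val_sum [simp]: "poly_val (\<Sum>i\<in>I. f i) x = (\<Sum>i\<in>I. poly_val (f i) x)"
  by (induction I rule: infinite_finite_induct) auto

lemma sum_of_monomials:
  fixes f :: "'a \<Rightarrow>\<^sub>0 'b::comm_monoid_add"
  shows "f = (\<Sum>m\<in>Poly_Mapping.keys f. Poly_Mapping.single m (Poly_Mapping.lookup f m))"
  by (rule poly_mapping_eqI) (auto simp: lookup_sum lookup_single when_def in_keys_iff)

lemma poly_val_mult [simp]: "poly_val (f * g) x = poly_val f x * poly_val g x"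
proof -
  have "f * g = (\<Sum>m\<in>Poly_Mapping.keys f. \<Sum>n\<in>Poly_Mapping.keys g.
      Poly_Mapping.single (m + n) (Poly_Mapping.lookup f m * Poly_Mapping.lookup g n))"
    by (subst (1) sum_of_monomials[of f], subst (1) sum_of_monomials[of g])
      (simp add: sum_product mult_single)
  then have "poly_val (f * g) x = (\<Sum>m\<in>Poly_Mapping.keys f. \<Sum>n\<in>Poly_Mapping.keys g.
      Poly_Mapping.lookup f m * Poly_Mapping.lookup g n * mono_val (m + n) x)"
    by (simp add: poly_val_single)
  also have "\<dots> = poly_val f x * poly_val g x"
    by (simp add: poly_val_def mono_val_def[symmetric] mono_val_add sum_product algebra_simps)
  finally show ?thesis .
qed

lemma poly_val_uminus [simp]: "poly_val (- f) x = - poly_val f x"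
  by (metis add.right_inverse eq_neg_iff_add_eq_0 poly_val_0 poly_val_add add.commute)

lemma poly_val_diff [simp]: "poly_val (f - g) x = poly_val f x - poly_val g x"
  by (metis diff_conv_add_uminus poly_val_add poly_val_uminus)

lemma poly_val_power [simp]: "poly_val (f ^ n) x = poly_val f x ^ n"
  by (induction n) auto

lemma polys_add [intro]: "f \<in> polys N \<Longrightarrow> g \<in> polys N \<Longrightarrow> f + g \<in> polys N"
  using keys_add[of f g] by (auto simp: polys_def)

lemma polys_mconst [intro, simp]: "mconst c \<in> polys N"
  by (auto simp: polys_def)

lemma polys_0 [intro, simp]: "0 \<in> polys N"
  by (auto simp: polys_def)

lemma polys_1 [intro, simp]: "1 \<in> polys N"
  using polys_mconst[of 1 N] by simp

lemma polys_mvar [intro]: "i < N \<Longrightarrow> mvar i \<in> polys N"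
  by (auto simp: polys_def mvar_def)

lemma polys_mult [intro]: "f \<in> polys N \<Longrightarrow> g \<in> polys N \<Longrightarrow> f * g \<in> polys N"
proof -
  assume *: "f \<in> polys N" "g \<in> polys N"
  show ?thesis
    unfolding polys_def
  proof safe
    fix m i assume m: "m \<in> Poly_Mapping.keys (f * g)" and i: "i \<in> Poly_Mapping.keys m"
    obtain a b where ab: "a \<in> Poly_Mapping.keys f" "b \<in> Poly_Mapping.keys g" "m = a + b"
      using keys_mult[of f g] m by blast
    then have "i \<in> Poly_Mapping.keys a \<union> Poly_Mapping.keys b"
      using keys_add[of a b] i by blast
    then show "i < N"
      using * ab by (auto simp: polys_def)
  qed
qed

lemma polys_uminus [intro]: "f \<in> polys N \<Longrightarrow> - f \<in> polys N"
  by (auto simp: polys_def)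

lemma polys_diff [intro]: "f \<in> polys N \<Longrightarrow> g \<in> polys N \<Longrightarrow> f - g \<in> polys N"
  by (metis diff_conv_add_uminus polys_add polys_uminus)

lemma polys_power [intro]: "f \<in> polys N \<Longrightarrow> f ^ n \<in> polys N"
  by (induction n) auto

lemma exponent_induct [consumes 1, case_names zero step]:
  fixes m :: "nat \<Rightarrow>\<^sub>0 nat"
  assumes "Poly_Mapping.keys m \<subseteq> S"
    and zero: "P 0"
    and step: "\<And>i m. i \<in> S \<Longrightarrow> P m \<Longrightarrow> P (Poly_Mapping.single i 1 + m)"
  shows "P m"
  using assms(1)
proof (induction "\<Sum>i\<in>Poly_Mapping.keys m. Poly_Mapping.lookup m i" arbitrary: m rule: less_induct)
  case (less m)
  show ?case
  proof (cases "m = 0")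
    case False
    then obtain i where i: "i \<in> Poly_Mapping.keys m"
      by (metis ex_in_conv keys_eq_empty)
    define m' where "m' = m - Poly_Mapping.single i 1"
    have lookup': "Poly_Mapping.lookup m' j = Poly_Mapping.lookup m j - (if j = i then 1 else 0)" for j
      by (simp add: m'_def lookup_minus lookup_single when_def)
    have m: "m = Poly_Mapping.single i 1 + m'"
      by (rule poly_mapping_eqI) (use i in \<open>auto simp: lookup_add lookup' lookup_single when_def in_keys_iff\<close>)
    have sub: "Poly_Mapping.keys m' \<subseteq> Poly_Mapping.keys m"
      by (auto simp: in_keys_iff lookup')
    have "(\<Sum>j\<in>Poly_Mapping.keys m'. Poly_Mapping.lookup m' j)
        = (\<Sum>j\<in>Poly_Mapping.keys m. Poly_Mapping.lookup m' j)"
      by (rule sum.mono_neutral_left) (use sub in \<open>auto simp: in_keys_iff\<close>)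
    also have "\<dots> < (\<Sum>j\<in>Poly_Mapping.keys m. Poly_Mapping.lookup m j)"
      by (rule sum_strict_mono_ex1) (use i in \<open>auto simp: lookup' in_keys_iff intro!: bexI[of _ i]\<close>)
    finally have "P m'"
      using less sub by blast
    then show ?thesis
      using step i less.prems m by auto
  qed (use zero in simp)
qed

text \<open>Polynomials are generated from constants by sums and products with variables. Multiplication
  by one variable at a time is all that an induction has to control.\<close>

lemma polys_induct [consumes 1, case_names const add var]:
  assumes "f \<in> polys N"
    and const: "\<And>c. P (mconst c)"
    and add: "\<And>f g. f \<in> polys N \<Longrightarrow> g \<in> polys N \<Longrightarrow> P f \<Longrightarrow> P g \<Longrightarrow> P (f + g)"
    and var: "\<And>i f. i < N \<Longrightarrow> f \<in> polys N \<Longrightarrow> P f \<Longrightarrow> P (mvar i * f)"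
  shows "P f"
proof -
  have mono: "P (Poly_Mapping.single m c) \<and> Poly_Mapping.single m c \<in> polys N"
    if "Poly_Mapping.keys m \<subseteq> {..<N}" for m c
    using that
  proof (induction m rule: exponent_induct)
    case zero
    then show ?case using const by auto
  next
    case (step i m)
    have "Poly_Mapping.single (Poly_Mapping.single i 1 + m) c = mvar i * Poly_Mapping.single m c"
      by (simp add: mvar_def mult_single)
    then show ?case
      using step var polys_mvar polys_mult by auto
  qed
  have "P (\<Sum>m\<in>S. Poly_Mapping.single m (Poly_Mapping.lookup f m)) \<and>
      (\<Sum>m\<in>S. Poly_Mapping.single m (Poly_Mapping.lookup f m)) \<in> polys N"
    if "finite S" "S \<subseteq> Poly_Mapping.keys f" for S
    using that
  proof (induction S)
    case empty
    then show ?case using const[of 0] by simp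
  next
    case (insert m S)
    then have "Poly_Mapping.keys m \<subseteq> {..<N}"
      using assms(1) by (auto simp: polys_def)
    then show ?case
      using insert mono[of m] add by auto
  qed
  from this[of "Poly_Mapping.keys f"] show ?thesis
    by (simp flip: sum_of_monomials)
qed

lemma holomorphic_on_poly_val:
  assumes "f \<in> polys N" and "\<And>i. i < N \<Longrightarrow> (\<lambda>s. \<gamma> s i) holomorphic_on D"
  shows "(\<lambda>s. poly_val f (\<gamma> s)) holomorphic_on D"
  using assms(1)
proof (induction f rule: polys_induct)
  case (add f g)
  then show ?case by (auto intro: holomorphic_intros)
next
  case (var i f)
  then show ?case using assms(2) by (auto intro: holomorphic_intros)
qed auto

text \<open>The generators in the definition of smoothness are numbered; the minors used below are
  naturally indexed by a set of columns from which one is missing.\<close>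

lemma smooth_at_finite_family:
  assumes "finite I"
    and van: "\<And>j. j \<in> I \<Longrightarrow> f j \<in> vanishing_ideal N X"
    and gen: "\<And>g. g \<in> vanishing_ideal N X \<Longrightarrow> \<exists>h\<in>polys N. poly_val h p \<noteq> 0 \<and>
           (\<exists>q. (\<forall>j\<in>I. q j \<in> polys N) \<and> h * g = (\<Sum>j\<in>I. q j * f j))"
    and indep: "\<And>c j. \<forall>i<N. (\<Sum>j\<in>I. c j * partial_deriv i (f j) p) = 0 \<Longrightarrow> j \<in> I \<Longrightarrow> c j = 0"
  shows "smooth_at N X p"
proof -
  obtain b where b: "bij_betw b {..<card I} I"
    using ex_bij_betw_nat_finite[OF \<open>finite I\<close>] by (auto simp: lessThan_atLeast0)
  have bI: "b j \<in> I" if "j < card I" for j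
    using b that by (auto simp: bij_betw_def)
  have reindex: "(\<Sum>j<card I. F (b j)) = (\<Sum>j\<in>I. F j)" for F :: "_ \<Rightarrow> complex"
    by (rule sum.reindex_bij_betw[OF b])
  have reindex': "(\<Sum>j<card I. F (b j)) = (\<Sum>j\<in>I. F j)" for F :: "_ \<Rightarrow> cpoly"
    by (rule sum.reindex_bij_betw[OF b])
  show ?thesis
    unfolding smooth_at_def
  proof (intro exI[of _ "card I"] exI[of _ "\<lambda>j. f (b j)"] conjI allI ballI impI)
    fix g assume "g \<in> vanishing_ideal N X"
    from gen[OF this] obtain h q where h: "h \<in> polys N" "poly_val h p \<noteq> 0" "\<forall>j\<in>I. q j \<in> polys N"
      "h * g = (\<Sum>j\<in>I. q j * f j)" by blast
    show "\<exists>h\<in>polys N. poly_val h p \<noteq> 0 \<and> (\<exists>q. (\<forall>j<card I. q j \<in> polys N) \<and>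
        h * g = (\<Sum>j<card I. q j * f (b j)))"
      using h bI reindex'[of "\<lambda>j. q j * f j"]
      by (intro bexI[of _ h] conjI exI[of _ "\<lambda>j. q (b j)"]) auto
  next
    fix c :: "nat \<Rightarrow> complex" and j
    assume c: "\<forall>i<N. (\<Sum>j<card I. c j * partial_deriv i (f (b j)) p) = 0" and j: "j < card I"
    define b' where "b' = inv_into {..<card I} b"
    have b': "b' (b j) = j" if "j < card I" for j
      using b that by (simp add: b'_def bij_betw_def inv_into_f_f)
    have "(\<Sum>j\<in>I. c (b' j) * partial_deriv i (f j) p) = 0" if "i < N" for i
      using c that reindex[of "\<lambda>j. c (b' j) * partial_deriv i (f j) p"] b' by simp
    from indep[of "\<lambda>j. c (b' j)" "b j"] this show "c j = 0"
      using b' j bI by auto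
  qed (use van bI in auto)
qed

section \<open>The chain rule for separately holomorphic functions\<close>

lemma hol_C2_subset: "f \<in> hol_C2 T \<Longrightarrow> S \<subseteq> T \<Longrightarrow> f \<in> hol_C2 S"
  unfolding hol_C2_def
  by (auto elim!: continuous_on_subset intro: holomorphic_on_subset)

text \<open>A continuous, separately holomorphic function is complex differentiable along the diagonal. The
  mixed difference \<open>F (s, s) - F (s, s0) - F (s0, s) + F (s0, s0)\<close> is the increment, between \<open>s0\<close>
  and \<open>s\<close>, of the function \<open>a \<mapsto> F (a, s) - F (a, s0)\<close>; that function is uniformly small for \<open>s\<close>
  near \<open>s0\<close>, hence so is its derivative by the Cauchy inequality, and the mixed difference is
  \<open>o(s - s0)\<close>. What remains is a sum of two functions of one variable.\<close>

lemma hol_C2_diagonal: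
  assumes "open W" and F: "F \<in> hol_C2 W"
  shows "(\<lambda>s. F (s, s)) holomorphic_on {s. (s, s) \<in> W}"
proof -
  have cont: "continuous_on W F"
    and hol1: "(\<lambda>a. F (a, b)) holomorphic_on {a. (a, b) \<in> W}"
    and hol2: "(\<lambda>b. F (a, b)) holomorphic_on {b. (a, b) \<in> W}" for a b
    using F by (auto simp: hol_C2_def)
  have "(\<lambda>s. F (s, s)) field_differentiable at s0" if s0: "(s0, s0) \<in> W" for s0
  proof -
    obtain A B where AB: "open A" "open B" "s0 \<in> A" "s0 \<in> B" "A \<times> B \<subseteq> W"
      using open_prod_elim[OF \<open>open W\<close> s0] by (metis mem_Sigma_iff)
    then have "open (A \<inter> B)" "s0 \<in> A \<inter> B" by auto
    then obtain r where r: "r > 0" "cball s0 r \<subseteq> A \<inter> B"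
      using open_contains_cball by blast
    define K where "K = cball s0 r"
    have KW: "K \<times> K \<subseteq> W"
      using r AB by (auto simp: K_def)
    have s0K: "s0 \<in> K" using r by (simp add: K_def)
    define h where "h = (\<lambda>s. F (s, s) - F (s, s0) - F (s0, s) + F (s0, s0))"
    have "uniformly_continuous_on (K \<times> K) F"
      by (rule compact_uniformly_continuous)
        (use cont KW in \<open>auto simp: K_def intro: continuous_on_subset compact_Times\<close>)
    then have unif: "\<exists>d>0. \<forall>p\<in>K \<times> K. \<forall>p'\<in>K \<times> K. dist p' p < d \<longrightarrow> dist (F p') (F p) < e" if "e > 0" for e
      using that unfolding uniformly_continuous_on_def by blast
    have "(h has_derivative (\<lambda>s. 0 * s)) (at s0)"
      unfolding has_derivative_at_alt
    proof (intro conjI allI impI)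
      fix e :: real assume e: "e > 0"
      then have "e * r / 2 > 0" using r by simp
      from unif[OF this] obtain d where d: "d > 0"
        "\<And>p p'. p \<in> K \<times> K \<Longrightarrow> p' \<in> K \<times> K \<Longrightarrow> dist p' p < d \<Longrightarrow> dist (F p') (F p) < e * r / 2"
        by blast
      show "\<exists>d>0. \<forall>s. norm (s - s0) < d \<longrightarrow> norm (h s - h s0 - 0 * (s - s0)) \<le> e * norm (s - s0)"
      proof (intro exI[of _ "min d (r / 2)"] conjI allI impI)
        show "min d (r / 2) > 0" using d r by simp
        fix s assume s: "norm (s - s0) < min d (r / 2)"
        have sK: "s \<in> K" using s r by (simp add: K_def dist_norm norm_minus_commute)
        define G where "G = (\<lambda>a. F (a, s) - F (a, s0))"
        have small: "norm (G a) \<le> e * r / 2" if "a \<in> K" for a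
          using d(2)[of "(a, s0)" "(a, s)"] that s sK s0K
          by (simp add: G_def dist_Pair_Pair dist_norm less_imp_le)
        have holG: "G holomorphic_on K"
          unfolding G_def
          by (intro holomorphic_on_diff holomorphic_on_subset[OF hol1]) (use KW sK s0K in auto)
        have bound: "norm (deriv G a) \<le> e" if "a \<in> ball s0 (r / 2)" for a
        proof -
          have "dist a s0 + r / 2 \<le> r"
            using that by (simp add: dist_commute)
          then have sub: "cball a (r / 2) \<subseteq> K"
            by (simp add: K_def cball_subset_cball_iff)
          have "norm ((deriv ^^ 1) G a) \<le> fact 1 * (e * r / 2) / (r / 2) ^ 1"
          proof (rule Cauchy_inequality)
            show "G holomorphic_on ball a (r / 2)"
              using holG sub ball_subset_cball by (meson holomorphic_on_subset subset_trans)
            show "continuous_on (cball a (r / 2)) G"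
              using holG sub by (meson holomorphic_on_imp_continuous_on continuous_on_subset)
            show "norm (G x) \<le> e * r / 2" if "norm (a - x) = r / 2" for x
              using small[of x] sub that by (auto simp: dist_norm subset_iff)
          qed (use r in simp)
          then show ?thesis using r by simp
        qed
        have "norm (G s - G s0) \<le> e * norm (s - s0)"
        proof (rule field_differentiable_bound[where f' = "deriv G"])
          fix a assume a: "a \<in> ball s0 (r / 2)"
          have "G holomorphic_on ball s0 r"
            using holG by (rule holomorphic_on_subset) (auto simp: K_def)
          then show "(G has_field_derivative deriv G a) (at a within ball s0 (r / 2))"
            by (rule holomorphic_derivI) (use a r in auto)
        next
          show "s \<in> ball s0 (r / 2)" "s0 \<in> ball s0 (r / 2)"
            using s r by (simp_all add: dist_norm norm_minus_commute)
        qed (use bound in simp_all)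
        moreover have "h s0 = 0" "h s = G s - G s0"
          by (auto simp: h_def G_def)
        ultimately show "norm (h s - h s0 - 0 * (s - s0)) \<le> e * norm (s - s0)"
          by simp
      qed
    qed (rule bounded_linear_mult_right)
    then have "h field_differentiable at s0"
      unfolding field_differentiable_def has_field_derivative_def by (rule exI[of _ 0])
    moreover have "(\<lambda>s. F (s, s0)) field_differentiable at s0"
      by (rule holomorphic_on_imp_differentiable_at[OF holomorphic_on_subset[OF hol1[of s0]], of "ball s0 r"])
        (use KW s0K r in \<open>auto simp: K_def\<close>)
    moreover have "(\<lambda>s. F (s0, s)) field_differentiable at s0"
      by (rule holomorphic_on_imp_differentiable_at[OF holomorphic_on_subset[OF hol2[of s0]], of "ball s0 r"])
        (use KW s0K r in \<open>auto simp: K_def\<close>)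
    ultimately have "(\<lambda>s. h s + F (s, s0) + F (s0, s) - F (s0, s0)) field_differentiable at s0"
      by (intro derivative_intros)
    then show ?thesis
      by (simp add: h_def)
  qed
  then show ?thesis
    by (auto simp: holomorphic_on_def intro: field_differentiable_at_within)
qed

lemma hol_C2_comp:
  assumes "open T" "f \<in> hol_C2 T" "open D" and \<alpha>: "\<alpha> holomorphic_on D" and \<beta>: "\<beta> holomorphic_on D"
    and T: "\<And>s. s \<in> D \<Longrightarrow> (\<alpha> s, \<beta> s) \<in> T"
  shows "(\<lambda>s. f (\<alpha> s, \<beta> s)) holomorphic_on D"
proof -
  have cont: "continuous_on T f"
    and hol1: "(\<lambda>a. f (a, b)) holomorphic_on {a. (a, b) \<in> T}"
    and hol2: "(\<lambda>b. f (a, b)) holomorphic_on {b. (a, b) \<in> T}" for a b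
    using assms(2) by (auto simp: hol_C2_def)
  define \<gamma> where "\<gamma> = (\<lambda>p. (\<alpha> (fst p), \<beta> (snd p)))"
  define W where "W = (D \<times> D) \<inter> \<gamma> -` T"
  have c\<gamma>: "continuous_on (D \<times> D) \<gamma>"
    unfolding \<gamma>_def
    by (intro continuous_intros continuous_on_compose2[OF holomorphic_on_imp_continuous_on[OF \<alpha>]]
        continuous_on_compose2[OF holomorphic_on_imp_continuous_on[OF \<beta>]]) auto
  then have "open W"
    unfolding W_def using assms by (intro continuous_open_preimage open_Times)
  have "(\<lambda>p. f (\<gamma> p)) \<in> hol_C2 W"
    unfolding hol_C2_def
  proof (intro CollectI conjI allI)
    show "continuous_on W (\<lambda>p. f (\<gamma> p))"
      by (rule continuous_on_compose2[OF cont continuous_on_subset[OF c\<gamma>]]) (auto simp: W_def)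
  next
    fix b
    show "(\<lambda>a. f (\<gamma> (a, b))) holomorphic_on {a. (a, b) \<in> W}"
    proof -
      have "\<alpha> holomorphic_on {a. (a, b) \<in> W}"
        using \<alpha> by (rule holomorphic_on_subset) (auto simp: W_def)
      moreover have "\<alpha> ` {a. (a, b) \<in> W} \<subseteq> {a. (a, \<beta> b) \<in> T}"
        by (auto simp: W_def \<gamma>_def)
      ultimately have "(\<lambda>a. f (a, \<beta> b)) \<circ> \<alpha> holomorphic_on {a. (a, b) \<in> W}"
        using holomorphic_on_compose_gen[OF _ hol1[of "\<beta> b"]] by simp
      then show ?thesis by (simp add: o_def \<gamma>_def)
    qed
  next
    fix a
    show "(\<lambda>b. f (\<gamma> (a, b))) holomorphic_on {b. (a, b) \<in> W}"
    proof -
      have "\<beta> holomorphic_on {b. (a, b) \<in> W}"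
        using \<beta> by (rule holomorphic_on_subset) (auto simp: W_def)
      moreover have "\<beta> ` {b. (a, b) \<in> W} \<subseteq> {b. (\<alpha> a, b) \<in> T}"
        by (auto simp: W_def \<gamma>_def)
      ultimately have "(\<lambda>b. f (\<alpha> a, b)) \<circ> \<beta> holomorphic_on {b. (a, b) \<in> W}"
        using holomorphic_on_compose_gen[OF _ hol2[of "\<alpha> a"]] by simp
      then show ?thesis by (simp add: o_def \<gamma>_def)
    qed
  qed
  from hol_C2_diagonal[OF \<open>open W\<close> this]
  have "(\<lambda>s. f (\<gamma> (s, s))) holomorphic_on {s. (s, s) \<in> W}" .
  moreover have "{s. (s, s) \<in> W} = D"
    using T by (auto simp: W_def \<gamma>_def)
  ultimately show ?thesis
    by (simp add: \<gamma>_def)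
qed

lemma topspace_CN_top [simp]: "topspace (CN_top N) = affine_space N"
  by (simp add: CN_top_def)

lemma continuous_map_CN_coordinate: "i < N \<Longrightarrow> continuous_map (CN_top N) euclidean (\<lambda>x. x i)"
  unfolding CN_top_def by (rule continuous_map_product_projection) simp

lemma continuous_map_into_CN:
  assumes "\<And>i. i < N \<Longrightarrow> continuous_on W (\<lambda>p. \<gamma> p i)" and "\<And>p. p \<in> W \<Longrightarrow> \<gamma> p \<in> affine_space N"
  shows "continuous_map (top_of_set W) (CN_top N) \<gamma>"
  using assms unfolding CN_top_def continuous_map_componentwise
  by (auto simp: PiE_def)

lemma continuous_on_hol_CN_comp:
  assumes g: "g \<in> hol_CN N S" and "\<And>i. i < N \<Longrightarrow> continuous_on W (\<lambda>p. \<gamma> p i)"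
    and "\<And>p. p \<in> W \<Longrightarrow> \<gamma> p \<in> affine_space N" and "\<And>p. p \<in> W \<Longrightarrow> \<gamma> p \<in> S"
  shows "continuous_on W (\<lambda>p. g (\<gamma> p))"
proof -
  have "continuous_map (top_of_set W) (subtopology (CN_top N) S) \<gamma>"
    using assms by (intro continuous_map_into_subtopology continuous_map_into_CN) auto
  moreover have "continuous_map (subtopology (CN_top N) S) euclidean g"
    using g by (simp add: hol_CN_def)
  ultimately have "continuous_map (top_of_set W) euclidean (g \<circ> \<gamma>)"
    by (rule continuous_map_compose)
  then show ?thesis by (simp add: o_def)
qed

lemma open_CN_preimage:
  assumes "open W" and S: "openin (CN_top N) S" and "\<And>i. i < N \<Longrightarrow> continuous_on W (\<lambda>p. \<gamma> p i)"
    and "\<And>p. p \<in> W \<Longrightarrow> \<gamma> p \<in> affine_space N"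
  shows "open {p \<in> W. \<gamma> p \<in> S}"
  using openin_continuous_map_preimage[OF continuous_map_into_CN S, of W \<gamma>] assms
  by (simp add: openin_open_eq)

text \<open>The variables are released one after the other: once the first \<open>m\<close> of them run along the curve,
  the next one is added by restricting a function of two variables to the diagonal.\<close>

lemma hol_CN_comp:
  assumes S: "openin (CN_top N) S" and g: "g \<in> hol_CN N S" and D: "open D"
    and \<gamma>: "\<And>i. i < N \<Longrightarrow> (\<lambda>s. \<gamma> s i) holomorphic_on D"
    and \<gamma>S: "\<And>s. s \<in> D \<Longrightarrow> \<gamma> s \<in> S"
  shows "(\<lambda>s. g (\<gamma> s)) holomorphic_on D"
proof -
  have SN: "S \<subseteq> affine_space N"
    using openin_subset[OF S] by simp
  define mix where "mix = (\<lambda>m s x i. if i < m then \<gamma> s i else x i)"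
  have mixN: "mix m s x \<in> affine_space N" if "m \<le> N" "x \<in> affine_space N" for m s x
    using that by (auto simp: mix_def PiE_def extensional_def)
  have cont_\<gamma>: "continuous_on D (\<lambda>s. \<gamma> s i)" if "i < N" for i
    using \<gamma>[OF that] by (rule holomorphic_on_imp_continuous_on)
  have "(\<lambda>s. g (mix m s x)) holomorphic_on {s \<in> D. mix m s x \<in> S}"
    if "m \<le> N" "x \<in> affine_space N" for m x
    using that
  proof (induction m arbitrary: x)
    case 0
    then show ?case by (simp add: mix_def)
  next
    case (Suc m)
    define \<delta> where "\<delta> = (\<lambda>p. mix m (fst p) (x(m := \<gamma> (snd p) m)))"
    define W where "W = {p \<in> D \<times> D. \<delta> p \<in> S}"
    have upd: "x(m := c) \<in> affine_space N" for c
      using Suc.prems by (auto simp: PiE_def extensional_def)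
    have \<delta>N: "\<delta> p \<in> affine_space N" for p
      using mixN upd Suc.prems by (simp add: \<delta>_def)
    have cont: "continuous_on (D \<times> D) (\<lambda>p. \<delta> p i)" if "i < N" for i
    proof -
      have "continuous_on (D \<times> D) (\<lambda>p. \<gamma> (fst p) i)" "continuous_on (D \<times> D) (\<lambda>p. \<gamma> (snd p) i)"
        by (rule continuous_on_compose2[OF cont_\<gamma>[OF that]]; auto intro: continuous_intros)+
      then show ?thesis
        by (cases "i < m"; cases "i = m") (simp_all add: \<delta>_def mix_def)
    qed
    have "open W"
      unfolding W_def using D cont \<delta>N S by (intro open_CN_preimage open_Times) auto
    have "(\<lambda>p. g (\<delta> p)) \<in> hol_C2 W"
      unfolding hol_C2_def
    proof (intro CollectI conjI allI)
      show "continuous_on W (\<lambda>p. g (\<delta> p))"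
      proof (rule continuous_on_hol_CN_comp[OF g])
        show "continuous_on W (\<lambda>p. \<delta> p i)" if "i < N" for i
          using cont[OF that] by (rule continuous_on_subset) (auto simp: W_def)
      qed (use \<delta>N in \<open>auto simp: W_def\<close>)
    next
      fix b
      show "(\<lambda>a. g (\<delta> (a, b))) holomorphic_on {a. (a, b) \<in> W}"
      proof (rule holomorphic_on_subset)
        show "(\<lambda>a. g (\<delta> (a, b))) holomorphic_on {a \<in> D. \<delta> (a, b) \<in> S}"
          unfolding \<delta>_def fst_conv snd_conv by (rule Suc.IH) (use upd Suc.prems in auto)
      qed (auto simp: W_def)
    next
      fix a
      show "(\<lambda>b. g (\<delta> (a, b))) holomorphic_on {b. (a, b) \<in> W}"
      proof (cases "\<exists>b. (a, b) \<in> W")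
        case True
        then obtain b0 where b0: "(a, b0) \<in> W" by blast
        define y where "y = \<delta> (a, b0)"
        have y: "y \<in> S" using b0 by (simp add: y_def W_def)
        have eq: "\<delta> (a, b) = y(m := \<gamma> b m)" for b
          by (auto simp: \<delta>_def y_def mix_def)
        have "(\<lambda>s. g (y(m := s))) holomorphic_on {s. y(m := s) \<in> S}"
          using g y Suc.prems by (auto simp: hol_CN_def)
        moreover have "(\<lambda>b. \<gamma> b m) holomorphic_on {b. (a, b) \<in> W}"
          by (rule holomorphic_on_subset[OF \<gamma>[of m]]) (use Suc.prems in \<open>auto simp: W_def\<close>)
        moreover have "(\<lambda>b. \<gamma> b m) ` {b. (a, b) \<in> W} \<subseteq> {s. y(m := s) \<in> S}"
          by (auto simp: W_def eq)
        ultimately have "(\<lambda>s. g (y(m := s))) \<circ> (\<lambda>b. \<gamma> b m) holomorphic_on {b. (a, b) \<in> W}"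
          using holomorphic_on_compose_gen by blast
        then show ?thesis
          by (simp add: eq o_def)
      next
        case False
        then have "{b. (a, b) \<in> W} = {}" by simp
        then show ?thesis by (simp only: holomorphic_on_empty)
      qed
    qed
    from hol_C2_diagonal[OF \<open>open W\<close> this]
    have "(\<lambda>s. g (\<delta> (s, s))) holomorphic_on {s. (s, s) \<in> W}" .
    moreover have "\<delta> (s, s) = mix (Suc m) s x" for s
      by (auto simp: \<delta>_def mix_def less_Suc_eq)
    ultimately show ?case
      by (simp add: W_def)
  qed
  note * = this
  show ?thesis
  proof (cases "D = {}")
    case False
    then obtain s0 where "s0 \<in> D" by blast
    have \<gamma>N: "\<gamma> s \<in> affine_space N" if "s \<in> D" for s
      using \<gamma>S[OF that] SN by blast
    have mix: "mix N s (\<gamma> s0) = \<gamma> s" if "s \<in> D" for s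
      using PiE_arb[OF \<gamma>N[OF that]] PiE_arb[OF \<gamma>N[OF \<open>s0 \<in> D\<close>]]
      by (auto simp: mix_def fun_eq_iff)
    have "{s \<in> D. mix N s (\<gamma> s0) \<in> S} = D"
      using mix \<gamma>S by auto
    then have "(\<lambda>s. g (mix N s (\<gamma> s0))) holomorphic_on D"
      using *[of N "\<gamma> s0"] \<gamma>N[OF \<open>s0 \<in> D\<close>] by simp
    then show ?thesis
      by (rule holomorphic_transform) (simp add: mix)
  qed (simp add: holomorphic_on_empty)
qed

lemma hol_C2_local:
  assumes "open T" and loc: "\<And>p. p \<in> T \<Longrightarrow> \<exists>T' f'. open T' \<and> p \<in> T' \<and> f' \<in> hol_C2 T' \<and> (\<forall>q\<in>T' \<inter> T. f q = f' q)"
  shows "f \<in> hol_C2 T"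
proof -
  have loc': "\<exists>T'. open T' \<and> p \<in> T' \<and> T' \<subseteq> T \<and> f \<in> hol_C2 T'" if p: "p \<in> T" for p
  proof -
    obtain T' f' where T': "open T'" "p \<in> T'" "f' \<in> hol_C2 T'" "\<forall>q\<in>T' \<inter> T. f q = f' q"
      using loc[OF p] by blast
    have f': "f' \<in> hol_C2 (T' \<inter> T)"
      using T'(3) by (rule hol_C2_subset) auto
    have "f \<in> hol_C2 (T' \<inter> T)"
      unfolding hol_C2_def
    proof (intro CollectI conjI allI)
      show "continuous_on (T' \<inter> T) f"
        by (rule continuous_on_eq[of _ f']) (use f' T'(4) in \<open>auto simp: hol_C2_def\<close>)
      show "(\<lambda>a. f (a, b)) holomorphic_on {a. (a, b) \<in> T' \<inter> T}" for b
        by (rule holomorphic_transform[of "\<lambda>a. f' (a, b)"]) (use f' T'(4) in \<open>auto simp: hol_C2_def\<close>)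
      show "(\<lambda>b. f (a, b)) holomorphic_on {b. (a, b) \<in> T' \<inter> T}" for a
        by (rule holomorphic_transform[of "\<lambda>b. f' (a, b)"]) (use f' T'(4) in \<open>auto simp: hol_C2_def\<close>)
    qed
    then show ?thesis
      using T' \<open>open T\<close> p by (intro exI[of _ "T' \<inter> T"]) auto
  qed
  have slice1: "open {a. (a, b) \<in> S}" and slice2: "open {b'. (a', b') \<in> S}"
    if "open S" for a' b and S :: "(complex \<times> complex) set"
    using open_vimage[OF that, of "\<lambda>a. (a, b)"] open_vimage[OF that, of "\<lambda>b. (a', b)"]
    by (simp_all add: vimage_def continuous_on_Pair continuous_on_id continuous_on_const)
  show ?thesis
    unfolding hol_C2_def
  proof (intro CollectI conjI allI)
    have "isCont f p" if "p \<in> T" for p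
      using loc'[OF that] by (auto simp: hol_C2_def continuous_on_eq_continuous_at)
    then show "continuous_on T f"
      by (simp add: continuous_at_imp_continuous_on)
  next
    fix b
    have "(\<lambda>a. f (a, b)) field_differentiable at a" if ab: "(a, b) \<in> T" for a
    proof -
      obtain T' where "open T'" "(a, b) \<in> T'" "f \<in> hol_C2 T'"
        using loc'[OF ab] by blast
      then show ?thesis
        using slice1[of T' b] by (intro holomorphic_on_imp_differentiable_at[of _ "{a. (a, b) \<in> T'}"]) (auto simp: hol_C2_def)
    qed
    then show "(\<lambda>a. f (a, b)) holomorphic_on {a. (a, b) \<in> T}"
      by (auto simp: holomorphic_on_def intro: field_differentiable_at_within)
  next
    fix a
    have "(\<lambda>b. f (a, b)) field_differentiable at b" if ab: "(a, b) \<in> T" for b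
    proof -
      obtain T' where "open T'" "(a, b) \<in> T'" "f \<in> hol_C2 T'"
        using loc'[OF ab] by blast
      then show ?thesis
        using slice2[of T' a] by (intro holomorphic_on_imp_differentiable_at[of _ "{b. (a, b) \<in> T'}"]) (auto simp: hol_C2_def)
    qed
    then show "(\<lambda>b. f (a, b)) holomorphic_on {b. (a, b) \<in> T}"
      by (auto simp: holomorphic_on_def intro: field_differentiable_at_within)
  qed
qed

section \<open>The deformed cone over a rational normal curve\<close>

primrec scroll_param :: "(nat \<Rightarrow> complex) \<Rightarrow> complex \<Rightarrow> complex \<Rightarrow> nat \<Rightarrow> complex" where
  "scroll_param \<sigma> z u 0 = u"
| "scroll_param \<sigma> z u (Suc j) = z * (scroll_param \<sigma> z u j + \<sigma> j)"

text \<open>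
  \<open>e\<close> and \<open>c\<close> describe an affine change of the coordinates \<open>x\<close> of the ambient space: the entries of
  the matrix are formed from \<open>y x i = x (e i) + c i\<close>. Identity and reversal are the two cases of \<open>e\<close>
  that occur, which is why \<open>e\<close> is an involution.
\<close>

locale scroll =
  fixes k :: nat and e :: "nat \<Rightarrow> nat" and c \<sigma> :: "nat \<Rightarrow> complex"
  assumes e_le: "i \<le> k \<Longrightarrow> e i \<le> k"
    and e_e: "i \<le> k \<Longrightarrow> e (e i) = i"
    and nontrivial: "\<exists>a\<in>{1..<k}. \<sigma> a \<noteq> 0"
begin

definition y :: "(nat \<Rightarrow> complex) \<Rightarrow> nat \<Rightarrow> complex" where
  "y x i = x (e i) + c i"

definition top_row :: "(nat \<Rightarrow> complex) \<Rightarrow> nat \<Rightarrow> complex" where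
  "top_row x i = y x i + \<sigma> i"

definition bot_row :: "(nat \<Rightarrow> complex) \<Rightarrow> nat \<Rightarrow> complex" where
  "bot_row x i = y x (Suc i)"

definition X :: "(nat \<Rightarrow> complex) set" where
  "X = {x \<in> affine_space (Suc k). \<forall>i<k. \<forall>j<k. top_row x i * bot_row x j = top_row x j * bot_row x i}"

text \<open>The values at \<open>m\<close> solve \<open>y (E p) i = scroll_param \<sigma> (fst p) (snd p) i\<close> for the coordinates,
  using that \<open>e\<close> is its own inverse.\<close>

definition E :: "complex \<times> complex \<Rightarrow> nat \<Rightarrow> complex" where
  "E p = (\<lambda>m\<in>{..<Suc k}. scroll_param \<sigma> (fst p) (snd p) (e m) - c (e m))"

text \<open>Where it is defined, the inverse of \<open>E\<close>; the column \<open>a\<close> is any one with nonzero top entry.\<close>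

definition coords :: "nat \<Rightarrow> (nat \<Rightarrow> complex) \<Rightarrow> complex \<times> complex" where
  "coords a x = (bot_row x a / top_row x a, y x 0)"

lemma E_affine: "E p \<in> affine_space (Suc k)"
  by (simp add: E_def)

lemma y_E: "i \<le> k \<Longrightarrow> y (E p) i = scroll_param \<sigma> (fst p) (snd p) i"
  using e_le[of i] e_e[of i] by (simp add: y_def E_def)

lemma top_E: "i < k \<Longrightarrow> top_row (E p) i = scroll_param \<sigma> (fst p) (snd p) i + \<sigma> i"
  by (simp add: top_row_def y_E)

lemma bot_E: "i < k \<Longrightarrow> bot_row (E p) i = fst p * top_row (E p) i"
  by (simp add: bot_row_def top_E y_E)

lemma E_in_X: "E p \<in> X"
  unfolding X_def using E_affine by (simp add: bot_E)

lemma affine_eqI: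
  assumes "x \<in> affine_space (Suc k)" "x' \<in> affine_space (Suc k)" "\<And>i. i \<le> k \<Longrightarrow> y x i = y x' i"
  shows "x = x'"
proof (rule PiE_ext[OF assms(1,2)])
  fix m assume "m \<in> {..<Suc k}"
  then show "x m = x' m"
    using assms(3)[of "e m"] e_le[of m] e_e[of m] by (simp add: y_def)
qed

text \<open>At \<open>E p\<close> the bottom row is a multiple of the top row. If the top row vanished, so would the
  bottom row, that is \<open>y\<close> from index 1 on, and then \<open>\<sigma> a = top_row (E p) a - y (E p) a\<close> would
  vanish for all \<open>a\<close> between 1 and \<open>k - 1\<close>.\<close>

lemma top_E_nonzero: "\<exists>a<k. top_row (E p) a \<noteq> 0"
proof (rule ccontr)
  assume *: "\<not> ?thesis"
  obtain a where a: "1 \<le> a" "a < k" "\<sigma> a \<noteq> 0"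
    using nontrivial by auto
  then obtain b where b: "a = Suc b" by (cases a) auto
  have "y (E p) a = 0"
    using bot_E[of b p] * a b by (simp add: bot_row_def)
  then have "top_row (E p) a \<noteq> 0"
    using a by (simp add: top_row_def)
  then show False using * a by auto
qed

text \<open>Rank at most one makes the bottom row \<open>z\<close> times the top row, with \<open>z\<close> read off in column \<open>a\<close>;
  this is the recursion defining \<open>scroll_param\<close>, started at \<open>y x 0\<close>.\<close>

lemma E_coords:
  assumes x: "x \<in> X" and a: "a < k" "top_row x a \<noteq> 0"
  shows "E (coords a x) = x"
proof (rule affine_eqI)
  define z where "z = bot_row x a / top_row x a"
  have z: "bot_row x j = z * top_row x j" if "j < k" for j
  proof -
    have "top_row x a * bot_row x j = top_row x j * bot_row x a"
      using x a that unfolding X_def by blast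
    then show ?thesis using a by (simp add: z_def field_simps)
  qed
  have "scroll_param \<sigma> z (y x 0) i = y x i" if "i \<le> k" for i
    using that
  proof (induction i)
    case (Suc i)
    then show ?case using z[of i] by (simp add: bot_row_def top_row_def)
  qed simp
  then show "y (E (coords a x)) i = y x i" if "i \<le> k" for i
    using that by (simp add: y_E coords_def z_def)
  show "x \<in> affine_space (Suc k)"
    using x unfolding X_def by blast
qed (rule E_affine)

lemma coords_E:
  assumes "a < k" "top_row (E p) a \<noteq> 0"
  shows "coords a (E p) = p"
  using assms by (simp add: coords_def bot_E y_E)

lemma inj_E: "inj E"
proof (rule injI)
  fix p q assume eq: "E p = E q"
  obtain a where a: "a < k" "top_row (E p) a \<noteq> 0"
    using top_E_nonzero[of p] by blast
  have "p = coords a (E p)"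
    using coords_E[OF a] by (rule sym)
  also have "\<dots> = coords a (E q)"
    by (simp only: eq)
  also have "\<dots> = q"
    by (rule coords_E) (use a eq in simp_all)
  finally show "p = q" .
qed

section \<open>Equations, local generators and smoothness\<close>

definition y_poly :: "nat \<Rightarrow> cpoly" where
  "y_poly i = mvar (e i) + mconst (c i)"

definition top_poly :: "nat \<Rightarrow> cpoly" where
  "top_poly i = y_poly i + mconst (\<sigma> i)"

definition minor :: "nat \<Rightarrow> nat \<Rightarrow> cpoly" where
  "minor a j = top_poly a * y_poly (Suc j) - y_poly (Suc a) * top_poly j"

lemma y_poly_in [intro]: "i \<le> k \<Longrightarrow> y_poly i \<in> polys (Suc k)"
  unfolding y_poly_def using e_le[of i] by (intro polys_add polys_mvar polys_mconst) simp

lemma top_poly_in [intro]: "i \<le> k \<Longrightarrow> top_poly i \<in> polys (Suc k)"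
  unfolding top_poly_def by (intro polys_add y_poly_in polys_mconst)

lemma minor_in [intro]: "a < k \<Longrightarrow> j < k \<Longrightarrow> minor a j \<in> polys (Suc k)"
  unfolding minor_def by (intro polys_diff polys_mult y_poly_in top_poly_in) auto

lemma poly_val_y [simp]: "poly_val (y_poly i) x = y x i"
  by (simp add: y_poly_def y_def)

lemma poly_val_top [simp]: "poly_val (top_poly i) x = top_row x i"
  by (simp add: top_poly_def top_row_def)

lemma poly_val_minor: "poly_val (minor a j) x = top_row x a * bot_row x j - bot_row x a * top_row x j"
  by (simp add: minor_def bot_row_def)

lemma algebraic_X: "algebraic_set (Suc k) X"
  unfolding algebraic_set_def
proof (intro exI[of _ "{minor a j | a j. a < k \<and> j < k}"] conjI)
  show "X = {x \<in> affine_space (Suc k). \<forall>f\<in>{minor a j | a j. a < k \<and> j < k}. poly_val f x = 0}"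
  proof safe
    fix x assume x: "x \<in> affine_space (Suc k)" and
      van: "\<forall>f\<in>{minor a j | a j. a < k \<and> j < k}. poly_val f x = 0"
    have "top_row x i * bot_row x j = top_row x j * bot_row x i" if "i < k" "j < k" for i j
    proof -
      have "minor i j \<in> {minor a j | a j. a < k \<and> j < k}"
        using that by blast
      with van have "poly_val (minor i j) x = 0" by blast
      then show ?thesis by (simp add: poly_val_minor mult.commute)
    qed
    then show "x \<in> X"
      using x by (simp add: X_def)
  qed (auto simp: X_def poly_val_minor mult.commute)
qed (use minor_in in blast)

lemma minor_vanishing: "a < k \<Longrightarrow> j < k \<Longrightarrow> minor a j \<in> vanishing_ideal (Suc k) X"
  using minor_in[of a j] by (auto simp: vanishing_ideal_def X_def poly_val_minor)

text \<open>The ideal generated by the minors through column \<open>a\<close>. The minor \<open>minor a a = 0\<close> is left out so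
  that the gradients of the generators can be independent.\<close>

definition pivot_ideal :: "nat \<Rightarrow> cpoly set" where
  "pivot_ideal a = {g. \<exists>q. (\<forall>j\<in>{..<k} - {a}. q j \<in> polys (Suc k)) \<and> g = (\<Sum>j\<in>{..<k} - {a}. q j * minor a j)}"

lemma pivot_ideal_0: "0 \<in> pivot_ideal a"
  by (auto simp: pivot_ideal_def intro!: exI[of _ "\<lambda>_. 0"])

lemma pivot_ideal_add:
  assumes "f \<in> pivot_ideal a" "g \<in> pivot_ideal a"
  shows "f + g \<in> pivot_ideal a"
proof -
  obtain q r where "\<forall>j\<in>{..<k} - {a}. q j \<in> polys (Suc k)" "f = (\<Sum>j\<in>{..<k} - {a}. q j * minor a j)"
    "\<forall>j\<in>{..<k} - {a}. r j \<in> polys (Suc k)" "g = (\<Sum>j\<in>{..<k} - {a}. r j * minor a j)"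
    using assms unfolding pivot_ideal_def by blast
  then show ?thesis
    unfolding pivot_ideal_def
    by (intro CollectI exI[of _ "\<lambda>j. q j + r j"]) (auto simp: sum.distrib distrib_right)
qed

lemma pivot_ideal_mult:
  assumes "f \<in> polys (Suc k)" "g \<in> pivot_ideal a"
  shows "f * g \<in> pivot_ideal a"
proof -
  obtain q where "\<forall>j\<in>{..<k} - {a}. q j \<in> polys (Suc k)" "g = (\<Sum>j\<in>{..<k} - {a}. q j * minor a j)"
    using assms unfolding pivot_ideal_def by blast
  then show ?thesis
    unfolding pivot_ideal_def using assms(1)
    by (intro CollectI exI[of _ "\<lambda>j. f * q j"]) (auto simp: sum_distrib_left mult.assoc)
qed

lemma minor_in_pivot_ideal: "j < k \<Longrightarrow> minor a j \<in> pivot_ideal a"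
proof (cases "j = a")
  case True
  then show ?thesis using pivot_ideal_0 by (simp add: minor_def mult.commute)
next
  case False
  assume "j < k"
  then show ?thesis
    unfolding pivot_ideal_def using False
    by (intro CollectI exI[of _ "\<lambda>i. if i = j then 1 else 0"]) (auto simp: if_distrib[of "\<lambda>x. x * _"] sum.delta cong: if_cong)
qed

definition subst_y0 :: "complex poly \<Rightarrow> cpoly" where
  "subst_y0 p = poly (map_poly (\<lambda>c. mconst c) p) (y_poly 0)"

lemma subst_y0_pCons [simp]: "subst_y0 (pCons a p) = mconst a + y_poly 0 * subst_y0 p"
  by (simp add: subst_y0_def map_poly_pCons)

lemma subst_y0_0 [simp]: "subst_y0 0 = 0"
  by (simp add: subst_y0_def)

lemma subst_y0_add: "subst_y0 (p + q) = subst_y0 p + subst_y0 q"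
  by (induction p q rule: poly_induct2) (auto simp: single_add algebra_simps)

lemma subst_y0_smult: "subst_y0 (smult r p) = mconst r * subst_y0 p"
  by (induction p) (auto simp: mult_single algebra_simps)

text \<open>The polynomial \<open>\<Sum>\<^sub>m C m (u) z ^ m\<close> with \<open>u = y 0\<close>, \<open>z = y (a + 1) / top a\<close>, and denominators
  cleared by \<open>top a ^ d\<close>.\<close>

definition homogeneous :: "nat \<Rightarrow> nat \<Rightarrow> (nat \<Rightarrow> complex poly) \<Rightarrow> cpoly" where
  "homogeneous a d C = (\<Sum>m\<le>d. subst_y0 (C m) * y_poly (Suc a) ^ m * top_poly a ^ (d - m))"

text \<open>Modulo the minors through column \<open>a\<close>, and up to a power of the pivot \<open>top a\<close>, the polynomial \<open>g\<close>
  is its own pullback to the \<open>(z, u)\<close>-plane, written in terms of \<open>y (a + 1)\<close>, \<open>top a\<close> and \<open>y 0\<close>.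
  Keeping the values on the plane in the definition makes a polynomial that vanishes on
  \<open>X\<close> reduce to zero.\<close>

definition reduced_by :: "nat \<Rightarrow> cpoly \<Rightarrow> nat \<Rightarrow> (nat \<Rightarrow> complex poly) \<Rightarrow> bool" where
  "reduced_by a g d C \<longleftrightarrow> (\<forall>z u. poly_val g (E (z, u)) = (\<Sum>m\<le>d. poly (C m) u * z ^ m)) \<and>
     top_poly a ^ d * g - homogeneous a d C \<in> pivot_ideal a"

lemma reduced_by_raise:
  assumes "reduced_by a g d C" "a < k"
  shows "reduced_by a g (Suc d) (C(Suc d := 0))"
proof -
  have "homogeneous a (Suc d) (C(Suc d := 0))
      = (\<Sum>m\<le>d. subst_y0 (C m) * y_poly (Suc a) ^ m * top_poly a ^ (Suc d - m))"
    by (simp add: homogeneous_def)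
  also have "\<dots> = top_poly a * homogeneous a d C"
    unfolding homogeneous_def sum_distrib_left
    by (rule sum.cong) (auto simp: Suc_diff_le algebra_simps)
  finally have "top_poly a ^ Suc d * g - homogeneous a (Suc d) (C(Suc d := 0))
      = top_poly a * (top_poly a ^ d * g - homogeneous a d C)"
    by (simp add: algebra_simps)
  then show ?thesis
    using assms pivot_ideal_mult[OF top_poly_in] by (simp add: reduced_by_def)
qed

lemma reduced_by_raise_le:
  assumes "reduced_by a g d C" "a < k" "d \<le> d'"
  shows "\<exists>C'. reduced_by a g d' C'"
  using assms(3)
proof (induction d' rule: dec_induct)
  case base
  then show ?case using assms by blast
next
  case (step n)
  then show ?case using reduced_by_raise[OF _ assms(2)] by blast
qed

lemma reduced_by_add:
  assumes "reduced_by a f d C" "reduced_by a g d C'"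
  shows "reduced_by a (f + g) d (\<lambda>m. C m + C' m)"
proof -
  have "homogeneous a d (\<lambda>m. C m + C' m) = homogeneous a d C + homogeneous a d C'"
    by (simp add: homogeneous_def subst_y0_add sum.distrib algebra_simps)
  then have "top_poly a ^ d * (f + g) - homogeneous a d (\<lambda>m. C m + C' m)
    = (top_poly a ^ d * f - homogeneous a d C) + (top_poly a ^ d * g - homogeneous a d C')"
    by (simp add: algebra_simps)
  then show ?thesis
    using assms pivot_ideal_add by (simp add: reduced_by_def sum.distrib distrib_right)
qed

definition reducible :: "nat \<Rightarrow> cpoly \<Rightarrow> bool" where
  "reducible a g \<longleftrightarrow> (\<exists>d C. reduced_by a g d C)"

lemma reducible_add:
  assumes "reducible a f" "reducible a g" "a < k"
  shows "reducible a (f + g)"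
proof -
  obtain d C d' C' where "reduced_by a f d C" "reduced_by a g d' C'"
    using assms by (auto simp: reducible_def)
  then have "\<exists>C. reduced_by a f (max d d') C" "\<exists>C. reduced_by a g (max d d') C"
    using reduced_by_raise_le assms(3) by (meson max.cobounded1 max.cobounded2)+
  then show ?thesis
    using reduced_by_add unfolding reducible_def by blast
qed

lemma reducible_mconst: "reducible a (mconst r)"
  unfolding reducible_def reduced_by_def
  by (intro exI[of _ 0] exI[of _ "\<lambda>_. [:r:]"]) (simp add: homogeneous_def pivot_ideal_0)

lemma reducible_mconst_mult:
  assumes "reducible a g"
  shows "reducible a (mconst r * g)"
proof -
  obtain d C where g: "reduced_by a g d C"
    using assms by (auto simp: reducible_def)
  have "homogeneous a d (\<lambda>m. smult r (C m)) = mconst r * homogeneous a d C"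
    by (simp add: homogeneous_def subst_y0_smult sum_distrib_left mult.assoc)
  then have "top_poly a ^ d * (mconst r * g) - homogeneous a d (\<lambda>m. smult r (C m))
      = mconst r * (top_poly a ^ d * g - homogeneous a d C)"
    by (simp add: algebra_simps)
  then have "reduced_by a (mconst r * g) d (\<lambda>m. smult r (C m))"
    using g pivot_ideal_mult by (simp add: reduced_by_def sum_distrib_left mult.assoc)
  then show ?thesis by (auto simp: reducible_def)
qed

lemma reducible_y0_mult:
  assumes "reducible a g"
  shows "reducible a (y_poly 0 * g)"
proof -
  obtain d C where g: "reduced_by a g d C"
    using assms by (auto simp: reducible_def)
  have "homogeneous a d (\<lambda>m. pCons 0 (C m)) = y_poly 0 * homogeneous a d C"
    by (simp add: homogeneous_def sum_distrib_left mult.assoc)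
  then have "top_poly a ^ d * (y_poly 0 * g) - homogeneous a d (\<lambda>m. pCons 0 (C m))
      = y_poly 0 * (top_poly a ^ d * g - homogeneous a d C)"
    by (simp add: algebra_simps)
  then have "reduced_by a (y_poly 0 * g) d (\<lambda>m. pCons 0 (C m))"
    using g pivot_ideal_mult[OF y_poly_in] by (simp add: reduced_by_def sum_distrib_left mult.assoc y_E)
  then show ?thesis by (auto simp: reducible_def)
qed

text \<open>By definition of the minor, \<open>top a * y (j + 1)\<close> equals \<open>y (a + 1) * top j\<close> modulo \<open>minor a j\<close>: the
  factor \<open>y (j + 1)\<close> is traded for \<open>top j\<close> at the price of one power of \<open>z\<close>, which shifts the
  coefficients \<open>C\<close> by one.\<close>

lemma reducible_y_Suc_mult:
  assumes "reducible a (top_poly j * g)" "j < k" "a < k" "g \<in> polys (Suc k)"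
  shows "reducible a (y_poly (Suc j) * g)"
proof -
  obtain d C where g: "reduced_by a (top_poly j * g) d C"
    using assms by (auto simp: reducible_def)
  define C' where "C' = case_nat 0 C"
  have "homogeneous a (Suc d) C' = y_poly (Suc a) * homogeneous a d C"
    unfolding homogeneous_def sum_distrib_left sum.atMost_Suc_shift
    by (simp add: C'_def algebra_simps)
  then have "top_poly a ^ Suc d * (y_poly (Suc j) * g) - homogeneous a (Suc d) C'
      = y_poly (Suc a) * (top_poly a ^ d * (top_poly j * g) - homogeneous a d C)
        + top_poly a ^ d * g * minor a j"
    by (simp add: minor_def algebra_simps)
  moreover have "y_poly (Suc a) * (top_poly a ^ d * (top_poly j * g) - homogeneous a d C) \<in> pivot_ideal a"
    using g assms by (intro pivot_ideal_mult) (auto simp: reduced_by_def)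
  moreover have "top_poly a ^ d * g * minor a j \<in> pivot_ideal a"
    using assms by (intro pivot_ideal_mult minor_in_pivot_ideal polys_mult polys_power top_poly_in) auto
  ultimately have "top_poly a ^ Suc d * (y_poly (Suc j) * g) - homogeneous a (Suc d) C' \<in> pivot_ideal a"
    by (simp add: pivot_ideal_add)
  moreover have "poly_val (y_poly (Suc j) * g) (E (z, u)) = (\<Sum>m\<le>Suc d. poly (C' m) u * z ^ m)" for z u
  proof -
    have "poly_val (y_poly (Suc j) * g) (E (z, u)) = z * poly_val (top_poly j * g) (E (z, u))"
      using bot_E[of j "(z, u)"] assms by (simp add: bot_row_def)
    also have "\<dots> = (\<Sum>m\<le>Suc d. poly (C' m) u * z ^ m)"
      using g unfolding sum.atMost_Suc_shift by (simp add: reduced_by_def C'_def sum_distrib_left algebra_simps)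
    finally show ?thesis .
  qed
  ultimately show ?thesis
    unfolding reducible_def reduced_by_def by blast
qed

lemma reducible_y_mult:
  assumes "reducible a g" "j \<le> k" "a < k" "g \<in> polys (Suc k)"
  shows "reducible a (y_poly j * g)"
  using assms(2)
proof (induction j)
  case 0
  then show ?case using reducible_y0_mult assms by blast
next
  case (Suc j)
  then have "reducible a (y_poly j * g + mconst (\<sigma> j) * g)"
    using assms by (intro reducible_add reducible_mconst_mult) auto
  then have "reducible a (top_poly j * g)"
    by (simp add: top_poly_def distrib_right)
  then show ?case
    using Suc assms by (intro reducible_y_Suc_mult) auto
qed

lemma reducible_polys:
  assumes "g \<in> polys (Suc k)" "a < k"
  shows "reducible a g"
  using assms(1)
proof (induction g rule: polys_induct)
  case (const r)
  show ?case by (rule reducible_mconst)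
next
  case (add f g)
  then show ?case using reducible_add assms(2) by blast
next
  case (var i g)
  have "mvar i * g = y_poly (e i) * g + mconst (- c (e i)) * g"
    using var e_e[of i] by (simp add: y_poly_def algebra_simps flip: single_add distrib_left)
  moreover have "reducible a \<dots>"
    using var assms(2) e_le[of i] by (intro reducible_add reducible_mconst_mult reducible_y_mult) auto
  ultimately show ?case by simp
qed

text \<open>The pullback of \<open>g\<close> to the plane is zero, hence all coefficients of its reduced form are.\<close>

lemma pivot_generates:
  assumes g: "g \<in> vanishing_ideal (Suc k) X" and a: "a < k"
  shows "\<exists>d. top_poly a ^ d * g \<in> pivot_ideal a"
proof -
  obtain d C where C: "\<And>z u. poly_val g (E (z, u)) = (\<Sum>m\<le>d. poly (C m) u * z ^ m)"
    "top_poly a ^ d * g - homogeneous a d C \<in> pivot_ideal a"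
    using reducible_polys[of g a] g a by (auto simp: vanishing_ideal_def reducible_def reduced_by_def)
  have "(\<Sum>m\<le>d. poly (C m) u * z ^ m) = 0" for z u
    using g E_in_X C(1)[of z u] by (auto simp: vanishing_ideal_def)
  then have "\<forall>m\<le>d. poly (C m) u = 0" for u
    using zero_polynom_imp_zero_coeffs[of "\<lambda>m. poly (C m) u" d] by auto
  then have "C m = 0" if "m \<le> d" for m
    using that poly_all_0_iff_0[of "C m"] by blast
  then have "homogeneous a d C = 0"
    by (simp add: homogeneous_def)
  then show ?thesis using C(2) by auto
qed

lemma y_upd: "i \<le> k \<Longrightarrow> m \<le> k \<Longrightarrow> y (x(e m := s)) i = (if i = m then s + c m else y x i)"
  using e_e[of i] e_e[of m] by (auto simp: y_def)

lemma y_has_derivative: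
  "i \<le> k \<Longrightarrow> m \<le> k \<Longrightarrow> ((\<lambda>s. y (p(e m := s)) i) has_field_derivative (if i = m then 1 else 0)) (at t)"
  by (auto simp: y_upd intro!: derivative_eq_intros)

lemma partial_minor:
  assumes "a < k" "j < k" "m \<le> k"
  shows "partial_deriv (e m) (minor a j) p =
    (if m = a then bot_row p j else 0) + (if m = Suc j then top_row p a else 0)
    - (if m = Suc a then top_row p j else 0) - (if m = j then bot_row p a else 0)"
proof -
  have "((\<lambda>s. poly_val (minor a j) (p(e m := s))) has_field_derivative
      ((if a = m then 1 else 0) * y p (Suc j) + (if Suc j = m then 1 else 0) * (y p a + \<sigma> a)
       - ((if Suc a = m then 1 else 0) * (y p j + \<sigma> j) + (if j = m then 1 else 0) * y p (Suc a)))) (at (p (e m)))"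
    unfolding poly_val_minor top_row_def bot_row_def
    by (rule derivative_eq_intros y_has_derivative refl | use assms in simp)+
  then show ?thesis
    unfolding partial_deriv_def by (subst DERIV_imp_deriv) (auto simp: top_row_def bot_row_def)
qed

text \<open>Local generation is \<open>pivot_generates\<close>. For the gradients, let \<open>C\<close> be the coefficients of a linear
  relation between them, \<open>T\<close> the pivot entry, \<open>z\<close> the ratio of the rows at \<open>p\<close>, and \<open>S\<close> the sum of
  \<open>C j * top_row p j\<close>. The relation in the direction of \<open>y m\<close> reads \<open>T * C (m - 1) = z * T * C m\<close>, up
  to multiples of \<open>S\<close> in the directions \<open>a\<close> and \<open>a + 1\<close>. Descending from \<open>C k = 0\<close> gives \<open>C j = 0\<close>
  for \<open>j > a\<close>; then direction \<open>a + 1\<close> gives \<open>S = 0\<close>, and the descent continues to \<open>C 0\<close>.\<close>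

lemma smooth_at_pivot:
  assumes p: "p \<in> X" and a: "a < k" "top_row p a \<noteq> 0"
  shows "smooth_at (Suc k) X p"
proof (rule smooth_at_finite_family[where I = "{..<k} - {a}" and f = "minor a"])
  fix g assume "g \<in> vanishing_ideal (Suc k) X"
  from pivot_generates[OF this a(1)] obtain d where d: "top_poly a ^ d * g \<in> pivot_ideal a" ..
  show "\<exists>h\<in>polys (Suc k). poly_val h p \<noteq> 0 \<and>
      (\<exists>q. (\<forall>j\<in>{..<k} - {a}. q j \<in> polys (Suc k)) \<and> h * g = (\<Sum>j\<in>{..<k} - {a}. q j * minor a j))"
    using d a by (intro bexI[of _ "top_poly a ^ d"] conjI polys_power top_poly_in) (auto simp: pivot_ideal_def)
next
  fix w :: "nat \<Rightarrow> complex" and j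
  assume eqs: "\<forall>i<Suc k. (\<Sum>j\<in>{..<k} - {a}. w j * partial_deriv i (minor a j) p) = 0"
    and j: "j \<in> {..<k} - {a}"
  define I where "I = {..<k} - {a}"
  define C where "C = (\<lambda>j. if j \<in> I then w j else 0)"
  define T where "T = top_row p a"
  define z where "z = bot_row p a / T"
  define S where "S = (\<Sum>j\<in>I. w j * top_row p j)"
  have T: "T \<noteq> 0" using a by (simp add: T_def)
  have bot: "bot_row p j = z * top_row p j" if "j < k" for j
  proof -
    have "top_row p a * bot_row p j = top_row p j * bot_row p a"
      using p a that unfolding X_def by blast
    then show ?thesis using T by (simp add: z_def T_def field_simps)
  qed
  have fin: "finite I" by (simp add: I_def)
  have eq: "(if m = a then z * S else 0) + (case m of 0 \<Rightarrow> 0 | Suc j \<Rightarrow> T * C j)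
      - (if m = Suc a then S else 0) - z * T * C m = 0" if m: "m \<le> k" for m
  proof -
    have "0 = (\<Sum>j\<in>I. w j * partial_deriv (e m) (minor a j) p)"
      using eqs e_le[OF m] by (simp add: I_def)
    also have "\<dots> = (\<Sum>j\<in>I. (if m = a then z * (w j * top_row p j) else 0) + (if m = Suc j then T * C j else 0)
        - (if m = Suc a then w j * top_row p j else 0) - (if m = j then z * T * C j else 0))"
    proof (rule sum.cong[OF refl])
      fix j assume "j \<in> I"
      then have "j < k" "C j = w j" by (auto simp: I_def C_def)
      then show "w j * partial_deriv (e m) (minor a j) p =
        (if m = a then z * (w j * top_row p j) else 0) + (if m = Suc j then T * C j else 0)
        - (if m = Suc a then w j * top_row p j else 0) - (if m = j then z * T * C j else 0)"
        using m a bot[of j] bot[of a] by (auto simp: partial_minor T_def algebra_simps)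
    qed
    also have "\<dots> = (\<Sum>j\<in>I. if m = a then z * (w j * top_row p j) else 0)
        + (\<Sum>j\<in>I. if m = Suc j then T * C j else 0)
        - (\<Sum>j\<in>I. if m = Suc a then w j * top_row p j else 0) - (\<Sum>j\<in>I. if m = j then z * T * C j else 0)"
      by (simp only: sum.distrib sum_subtractf)
    also have "(\<Sum>j\<in>I. if m = a then z * (w j * top_row p j) else 0) = (if m = a then z * S else 0)"
      by (simp add: S_def sum_distrib_left)
    also have "(\<Sum>j\<in>I. if m = Suc j then T * C j else 0) = (case m of 0 \<Rightarrow> 0 | Suc j \<Rightarrow> T * C j)"
      using fin by (cases m) (auto simp: C_def sum.delta')
    also have "(\<Sum>j\<in>I. if m = Suc a then w j * top_row p j else 0) = (if m = Suc a then S else 0)"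
      by (simp add: S_def)
    also have "(\<Sum>j\<in>I. if m = j then z * T * C j else 0) = z * T * C m"
      using fin by (simp add: sum.delta' C_def)
    finally show ?thesis by simp
  qed
  have above: "C (k - n) = 0" if "a < k - n" for n
    using that
  proof (induction n)
    case 0
    then show ?case by (simp add: C_def I_def)
  next
    case (Suc n)
    then have "k - n = Suc (k - Suc n)" by simp
    then show ?case
      using eq[of "k - n"] Suc T by auto
  qed
  have "C (Suc a) = 0" using above[of "k - Suc a"] a by simp
  moreover have "C a = 0" by (simp add: C_def I_def)
  ultimately have S: "S = 0"
    using eq[of "Suc a"] a by simp
  have all: "C (k - n) = 0" for n
  proof (induction n)
    case 0
    then show ?case by (simp add: C_def I_def)
  next
    case (Suc n)
    show ?case
    proof (cases "n < k")
      case True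
      then have m: "k - n = Suc (k - Suc n)" "Suc (k - Suc n) \<le> k" by simp_all
      have "T * C (k - Suc n) = 0"
        using eq[OF m(2)] Suc m(1) by (simp add: S split: if_split_asm)
      then show ?thesis using T by simp
    qed (use Suc in simp)
  qed
  show "w j = 0"
    using all[of "k - j"] j by (simp add: C_def I_def)
qed (use a minor_vanishing in auto)

section \<open>Holomorphy of the parametrisation and of its inverse\<close>

lemma holomorphic_scroll_param:
  assumes "\<alpha> holomorphic_on D" "\<beta> holomorphic_on D"
  shows "(\<lambda>s. scroll_param \<sigma> (\<alpha> s) (\<beta> s) i) holomorphic_on D"
  using assms by (induction i) (auto intro!: holomorphic_intros)

lemma holomorphic_E:
  assumes "\<alpha> holomorphic_on D" "\<beta> holomorphic_on D"
  shows "(\<lambda>s. E (\<alpha> s, \<beta> s) i) holomorphic_on D"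
  using holomorphic_scroll_param[OF assms, of "e i"]
  by (cases "i < Suc k") (auto simp: E_def intro!: holomorphic_intros)

lemma continuous_on_scroll_param: "continuous_on A (\<lambda>p. scroll_param \<sigma> (fst p) (snd p) i)"
  by (induction i) (auto intro!: continuous_intros)

lemma continuous_on_E: "continuous_on A (\<lambda>p. E p i)"
  using continuous_on_scroll_param[of A "e i"]
  by (cases "i < Suc k") (auto simp: E_def intro!: continuous_intros)

lemma open_E_vimage: "openin (CN_top (Suc k)) S \<Longrightarrow> open (E -` S)"
  using open_CN_preimage[of UNIV "Suc k" S E] continuous_on_E E_affine by (simp add: vimage_def)

lemma hol_C2_E:
  assumes S: "openin (CN_top (Suc k)) S" and g: "g \<in> hol_CN (Suc k) S" and T: "E ` T \<subseteq> S" "open T"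
  shows "(\<lambda>p. g (E p)) \<in> hol_C2 T"
  unfolding hol_C2_def
proof (intro CollectI conjI allI)
  show "continuous_on T (\<lambda>p. g (E p))"
    by (rule continuous_on_hol_CN_comp[OF g continuous_on_E E_affine]) (use T in auto)
  fix a b
  have "open {a. (a, b) \<in> T}" "open {b. (a, b) \<in> T}"
    using open_vimage[OF T(2), of "\<lambda>a. (a, b)"] open_vimage[OF T(2), of "\<lambda>b. (a, b)"]
    by (simp_all add: vimage_def continuous_on_Pair continuous_on_id continuous_on_const)
  then show "(\<lambda>a. g (E (a, b))) holomorphic_on {a. (a, b) \<in> T}"
    "(\<lambda>b. g (E (a, b))) holomorphic_on {b. (a, b) \<in> T}"
    using T by (auto intro!: hol_CN_comp[OF S g] holomorphic_E holomorphic_intros)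
qed

definition coords_domain :: "nat \<Rightarrow> (complex \<times> complex) set \<Rightarrow> (nat \<Rightarrow> complex) set" where
  "coords_domain a T = {x \<in> affine_space (Suc k). top_row x a \<noteq> 0 \<and> coords a x \<in> T}"

lemma continuous_map_y: "i \<le> k \<Longrightarrow> continuous_map (CN_top (Suc k)) euclidean (\<lambda>x. y x i)"
  unfolding y_def using e_le[of i] by (intro continuous_intros continuous_map_CN_coordinate) auto

lemma continuous_map_coords:
  assumes a: "a < k"
  shows "continuous_map (subtopology (CN_top (Suc k)) {x. top_row x a \<noteq> 0}) euclidean (coords a)"
proof -
  define Y where "Y = subtopology (CN_top (Suc k)) {x. top_row x a \<noteq> 0}"
  have y: "continuous_map Y euclidean (\<lambda>x. y x i)" if "i \<le> k" for i
    unfolding Y_def using continuous_map_y[OF that] by (rule continuous_map_from_subtopology)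
  have "continuous_map Y euclidean (\<lambda>x. top_row x a)"
    unfolding top_row_def using a by (intro y continuous_map_add continuous_map_canonical_const) simp
  moreover have "continuous_map Y euclidean (\<lambda>x. bot_row x a)" "continuous_map Y euclidean (\<lambda>x. y x 0)"
    unfolding bot_row_def using a by (intro y; simp)+
  moreover have "top_row x a \<noteq> 0" if "x \<in> topspace Y" for x
    using that by (simp add: Y_def)
  ultimately have "continuous_map Y euclidean (coords a)"
    unfolding coords_def continuous_map_atin limitin_canonical_iff
    by (intro ballI tendsto_Pair tendsto_divide) blast+
  then show ?thesis by (simp add: Y_def)
qed

lemma openin_coords_domain:
  assumes a: "a < k" and T: "open T"
  shows "openin (CN_top (Suc k)) (coords_domain a T)"
proof -
  let ?O = "{x. top_row x a \<noteq> 0}"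
  have "continuous_map (CN_top (Suc k)) euclidean (\<lambda>x. top_row x a)"
    unfolding top_row_def using a by (intro continuous_map_y continuous_map_add continuous_map_canonical_const) simp
  then have "openin (CN_top (Suc k)) {x \<in> topspace (CN_top (Suc k)). top_row x a \<in> - {0}}"
    by (rule openin_continuous_map_preimage) auto
  then have O: "openin (CN_top (Suc k)) (affine_space (Suc k) \<inter> ?O)"
    by (rule back_subst[of "openin (CN_top (Suc k))"]) auto
  have "openin (subtopology (CN_top (Suc k)) ?O)
      {x \<in> topspace (subtopology (CN_top (Suc k)) ?O). coords a x \<in> T}"
    using continuous_map_coords[OF a] by (rule openin_continuous_map_preimage) (use T in simp)
  also have "subtopology (CN_top (Suc k)) ?O = subtopology (CN_top (Suc k)) (affine_space (Suc k) \<inter> ?O)"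
    using subtopology_restrict[of "CN_top (Suc k)" ?O] by simp
  finally have "openin (CN_top (Suc k)) {x \<in> topspace (subtopology (CN_top (Suc k)) (affine_space (Suc k) \<inter> ?O)). coords a x \<in> T}"
    using O by (rule openin_trans_full)
  then show ?thesis
    by (rule back_subst[of "openin (CN_top (Suc k))"]) (auto simp: coords_domain_def)
qed

lemma hol_CN_coords:
  assumes a: "a < k" and T: "open T" and f: "f \<in> hol_C2 T"
  shows "(\<lambda>x. f (coords a x)) \<in> hol_CN (Suc k) (coords_domain a T)"
  unfolding hol_CN_def
proof (intro CollectI conjI ballI allI impI)
  have "continuous_map (subtopology (CN_top (Suc k)) (coords_domain a T)) euclidean (coords a)"
    using continuous_map_coords[OF a] by (rule continuous_map_from_subtopology_mono) (auto simp: coords_domain_def)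
  then have "continuous_map (subtopology (CN_top (Suc k)) (coords_domain a T)) (top_of_set T) (coords a)"
    by (rule continuous_map_into_subtopology) (auto simp: coords_domain_def)
  moreover have "continuous_map (top_of_set T) euclidean f"
    using f by (simp add: hol_C2_def)
  ultimately have "continuous_map (subtopology (CN_top (Suc k)) (coords_domain a T)) euclidean (f \<circ> coords a)"
    by (rule continuous_map_compose)
  then show "continuous_map (subtopology (CN_top (Suc k)) (coords_domain a T)) euclidean (\<lambda>x. f (coords a x))"
    by (simp add: o_def)
next
  fix x i assume x: "x \<in> coords_domain a T" and i: "i < Suc k"
  define m where "m = e i"
  have m: "m \<le> k" "i = e m"
    using i e_le[of i] e_e[of i] by (auto simp: m_def)
  let ?D = "{s. x(i := s) \<in> coords_domain a T}"
  have "continuous_map (top_of_set UNIV) (CN_top (Suc k)) (\<lambda>s. x(i := s))"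
  proof (rule continuous_map_into_CN)
    show "continuous_on UNIV (\<lambda>s. (x(i := s)) j)" for j
      by (cases "i = j") auto
    show "x(i := s) \<in> affine_space (Suc k)" for s
      using x i by (auto simp: coords_domain_def PiE_def extensional_def)
  qed
  from openin_continuous_map_preimage[OF this openin_coords_domain[OF a T]]
  have "open ?D" by simp
  have hy: "(\<lambda>s. y (x(i := s)) j) holomorphic_on ?D" if "j \<le> k" for j
    using m that by (cases "j = m") (auto simp: y_upd intro!: holomorphic_intros)
  have ht: "(\<lambda>s. top_row (x(i := s)) a) holomorphic_on ?D" and hb: "(\<lambda>s. bot_row (x(i := s)) a) holomorphic_on ?D"
    unfolding top_row_def bot_row_def using a by (auto intro!: hy holomorphic_intros)
  have "(\<lambda>s. f (bot_row (x(i := s)) a / top_row (x(i := s)) a, y (x(i := s)) 0)) holomorphic_on ?D"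
    by (rule hol_C2_comp[OF T f \<open>open ?D\<close>])
      (auto intro!: holomorphic_on_divide ht hb hy, auto simp: coords_domain_def coords_def)
  then show "(\<lambda>s. f (coords a (x(i := s)))) holomorphic_on ?D"
    by (simp add: coords_def)
qed

text \<open>Joining two points of the plane by a line reduces this to entire functions of one variable,
  which have no zero divisors.\<close>

lemma common_nonzero:
  assumes f: "f \<in> polys (Suc k)" "poly_val f (E p) \<noteq> 0" and g: "g \<in> polys (Suc k)" "poly_val g (E q) \<noteq> 0"
  shows "\<exists>r. poly_val f (E r) \<noteq> 0 \<and> poly_val g (E r) \<noteq> 0"
proof (rule ccontr)
  assume no: "\<not> ?thesis"
  then have zero: "poly_val g (E r) = 0" if "poly_val f (E r) \<noteq> 0" for r
    using that by blast
  define l where "l = (\<lambda>s. (fst p + s * (fst q - fst p), snd p + s * (snd q - snd p)))"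
  have l: "l 0 = p" "l 1 = q" by (auto simp: l_def)
  have hol: "(\<lambda>s. poly_val h (E (l s))) holomorphic_on UNIV" if "h \<in> polys (Suc k)" for h
    unfolding l_def using that by (rule holomorphic_on_poly_val) (intro holomorphic_E holomorphic_intros)
  have "open {s. poly_val f (E (l s)) \<noteq> 0}"
    using holomorphic_on_imp_continuous_on[OF hol[OF f(1)]]
    by (intro open_Collect_neq continuous_on_const)
  then have "poly_val g (E (l 1)) = 0"
    by (rule analytic_continuation_open[OF _ open_UNIV _ connected_UNIV subset_UNIV hol[OF g(1)]
        holomorphic_on_const _ UNIV_I]) (use zero f(2) l in auto)
  then show False using g l by simp
qed

text \<open>A holomorphic function in the chart extends to an open set of the ambient space: the formula
  \<open>coords a\<close> makes sense wherever the top entry in column \<open>a\<close> is nonzero, not only on \<open>X\<close>.\<close>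

lemma local_extension:
  assumes "open T" "h \<in> hol_C2 T" "q \<in> T"
  shows "\<exists>S g. openin (CN_top (Suc k)) S \<and> E q \<in> S \<and> g \<in> hol_CN (Suc k) S \<and>
           (\<forall>x\<in>S \<inter> X. \<exists>r\<in>T. x = E r \<and> g x = h r)"
proof -
  obtain a where a: "a < k" "top_row (E q) a \<noteq> 0"
    using top_E_nonzero by blast
  show ?thesis
  proof (intro exI conjI ballI)
    show "openin (CN_top (Suc k)) (coords_domain a T)"
      using a(1) assms(1) by (rule openin_coords_domain)
    show "(\<lambda>x. h (coords a x)) \<in> hol_CN (Suc k) (coords_domain a T)"
      using a(1) assms(1,2) by (rule hol_CN_coords)
    show "E q \<in> coords_domain a T"
      using a assms(3) E_affine by (simp add: coords_domain_def coords_E)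
    fix x assume "x \<in> coords_domain a T \<inter> X"
    then show "\<exists>r\<in>T. x = E r \<and> h (coords a x) = h r"
      using a(1) E_coords by (intro bexI[of _ "coords a x"]) (auto simp: coords_domain_def)
  qed
qed

text \<open>The neighbourhoods provided by \<open>local_extension\<close>, applied to the zero function, lie in the image.\<close>

lemma openin_E_image:
  assumes T: "open T"
  shows "openin (subtopology (CN_top (Suc k)) X) (E ` T)"
proof (subst openin_subopen, intro ballI)
  fix x assume "x \<in> E ` T"
  then obtain q where q: "q \<in> T" "x = E q" by blast
  have "(\<lambda>_. 0) \<in> hol_C2 T" by (simp add: hol_C2_def)
  from local_extension[OF T this q(1)] obtain S where
    S: "openin (CN_top (Suc k)) S" "E q \<in> S" "\<forall>x\<in>S \<inter> X. \<exists>r\<in>T. x = E r" by blast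
  then show "\<exists>S. openin (subtopology (CN_top (Suc k)) X) S \<and> x \<in> S \<and> S \<subseteq> E ` T"
    using q E_in_X by (intro exI[of _ "S \<inter> X"]) (auto simp: openin_subtopology_Int)
qed

lemma open_E_vimage_subtopology:
  "openin (subtopology (CN_top (Suc k)) X) W \<Longrightarrow> open (E -` W)"
proof -
  assume "openin (subtopology (CN_top (Suc k)) X) W"
  then obtain S where "openin (CN_top (Suc k)) S" "W = S \<inter> X"
    by (auto simp: openin_subtopology)
  then show ?thesis
    using open_E_vimage[of S] E_in_X by (simp add: vimage_def)
qed

lemma Hol_E:
  assumes W: "openin (subtopology (CN_top (Suc k)) X) W" and f: "f \<in> Hol (analytification (Suc k) X) W"
  shows "(\<lambda>p. f (E p)) \<in> hol_C2 (E -` W)"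
proof (rule hol_C2_local)
  show "open (E -` W)" using W by (rule open_E_vimage_subtopology)
  fix p assume "p \<in> E -` W"
  then obtain S g where S: "openin (CN_top (Suc k)) S" "E p \<in> S" "g \<in> hol_CN (Suc k) S"
    "\<forall>x\<in>S \<inter> W. f x = g x"
    using f by (auto simp: analytification_def)
  then show "\<exists>T' f'. open T' \<and> p \<in> T' \<and> f' \<in> hol_C2 T' \<and> (\<forall>q\<in>T' \<inter> E -` W. f (E q) = f' q)"
    using hol_C2_E[OF S(1,3), of "E -` S"] open_E_vimage
    by (intro exI[of _ "E -` S"] exI[of _ "\<lambda>p. g (E p)"]) auto
qed

end

section \<open>The two charts of the deformed surface\<close>

text \<open>With \<open>\<sigma> j = t (k - j)\<close> and \<open>j = k\<close> this is the second component of the gluing map.\<close>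

lemma scroll_param_sum: "scroll_param \<sigma> z u j = z ^ j * u + (\<Sum>i<j. \<sigma> i * z ^ (j - i))"
proof (induction j)
  case (Suc j)
  have "(\<Sum>i<j. \<sigma> i * z ^ (Suc j - i)) = z * (\<Sum>i<j. \<sigma> i * z ^ (j - i))"
    unfolding sum_distrib_left by (rule sum.cong) (auto simp: Suc_diff_le)
  then show ?case using Suc by (simp add: algebra_simps)
qed simp

locale deformation =
  fixes k :: nat and t :: "nat \<Rightarrow> complex"
  assumes t_nonzero: "\<exists>i\<in>{1..k-1}. t i \<noteq> 0"
begin

text \<open>A nonzero \<open>s 0\<close> would add the term \<open>s 0 * z ^ k\<close> to the gluing map, and \<open>s k\<close> would shift the
  coordinate \<open>v = x\<^sub>k + s k\<close>; both are set to zero because \<open>t k\<close> and \<open>t 0\<close> are arbitrary.\<close>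

definition s :: "nat \<Rightarrow> complex" where
  "s j = (if 1 \<le> j \<and> j < k then t (k - j) else 0)"

sublocale U: scroll k "\<lambda>i. i" "\<lambda>_. 0" s
proof
  obtain i where i: "1 \<le> i" "i \<le> k - 1" "t i \<noteq> 0"
    using t_nonzero by auto
  then have "s (k - i) \<noteq> 0" "k - i \<in> {1..<k}"
    by (auto simp: s_def)
  then show "\<exists>a\<in>{1..<k}. s a \<noteq> 0" by blast
qed auto

sublocale V: scroll k "\<lambda>i. k - i" "\<lambda>i. s (k - i)" "\<lambda>i. - s (k - i)"
proof
  obtain i where i: "1 \<le> i" "i \<le> k - 1" "t i \<noteq> 0"
    using t_nonzero by auto
  then have "- s (k - i) \<noteq> 0" "i \<in> {1..<k}"
    by (auto simp: s_def)
  then show "\<exists>a\<in>{1..<k}. - s (k - a) \<noteq> 0" by blast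
qed auto

lemma V_top_row: "i < k \<Longrightarrow> V.top_row x i = U.bot_row x (k - Suc i)"
  by (simp add: V.top_row_def V.y_def U.bot_row_def U.y_def Suc_diff_Suc)

lemma V_bot_row: "V.bot_row x i = U.top_row x (k - Suc i)"
  by (simp add: U.top_row_def V.y_def V.bot_row_def U.y_def)

text \<open>Reversal exchanges the rows and reverses the columns, and minors only change sign.\<close>

lemma V_X: "V.X = U.X"
proof (rule set_eqI)
  fix x
  show "x \<in> V.X \<longleftrightarrow> x \<in> U.X"
  proof
    assume x: "x \<in> V.X"
    have "U.top_row x i * U.bot_row x j = U.top_row x j * U.bot_row x i" if "i < k" "j < k" for i j
    proof -
      have "V.top_row x (k - Suc j) * V.bot_row x (k - Suc i) = V.top_row x (k - Suc i) * V.bot_row x (k - Suc j)"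
        using x that unfolding V.X_def by simp
      then show ?thesis
        using that by (simp add: V_top_row V_bot_row mult.commute)
    qed
    then show "x \<in> U.X" using x by (simp add: U.X_def V.X_def)
  next
    assume x: "x \<in> U.X"
    have "V.top_row x i * V.bot_row x j = V.top_row x j * V.bot_row x i" if "i < k" "j < k" for i j
    proof -
      have "U.top_row x (k - Suc j) * U.bot_row x (k - Suc i) = U.top_row x (k - Suc i) * U.bot_row x (k - Suc j)"
        using x that unfolding U.X_def by simp
      then show ?thesis
        using that by (simp add: V_top_row V_bot_row mult.commute)
    qed
    then show "x \<in> V.X" using x by (simp add: U.X_def V.X_def)
  qed
qed

text \<open>If both rows vanish, column \<open>a - 1\<close> gives \<open>x a = 0\<close> and column \<open>a\<close> gives \<open>x a + s a = 0\<close>, for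
  every \<open>a\<close> with \<open>0 < a < k\<close>.\<close>

lemma row_nonzero: "(\<exists>a<k. U.top_row x a \<noteq> 0) \<or> (\<exists>b<k. V.top_row x b \<noteq> 0)"
proof (rule ccontr)
  assume *: "\<not> ?thesis"
  obtain a where a: "1 \<le> a" "a < k" "s a \<noteq> 0"
    using U.nontrivial by auto
  then have "V.top_row x (k - a) = x a"
    by (simp add: V.top_row_def V.y_def)
  moreover have "V.top_row x (k - a) = 0" "U.top_row x a = 0"
    using * a by auto
  ultimately show False
    using a by (simp add: U.top_row_def U.y_def)
qed

lemma X_covered: "U.X = range U.E \<union> range V.E"
proof
  show "U.X \<subseteq> range U.E \<union> range V.E"
  proof
    fix x assume x: "x \<in> U.X"
    from row_nonzero[of x] show "x \<in> range U.E \<union> range V.E"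
    proof (elim disjE exE conjE)
      fix a assume "a < k" "U.top_row x a \<noteq> 0"
      then show ?thesis using U.E_coords[OF x, of a] by (metis UnI1 rangeI)
    next
      fix b assume "b < k" "V.top_row x b \<noteq> 0"
      then show ?thesis using V.E_coords[of x b] x V_X by (metis UnI2 rangeI)
    qed
  qed
  show "range U.E \<union> range V.E \<subseteq> U.X"
    using U.E_in_X V.E_in_X V_X by auto
qed

lemma V_E_in_range_U:
  assumes "\<xi> \<noteq> 0"
  shows "V.E (\<xi>, v) \<in> range U.E"
proof -
  obtain b where b: "b < k" "V.top_row (V.E (\<xi>, v)) b \<noteq> 0"
    using V.top_E_nonzero by blast
  then have "U.top_row (V.E (\<xi>, v)) (k - Suc b) \<noteq> 0"
    using assms V.bot_E[of b "(\<xi>, v)"] by (simp flip: V_bot_row)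
  then show ?thesis
    using U.E_coords[of "V.E (\<xi>, v)" "k - Suc b"] V.E_in_X[of "(\<xi>, v)"] V_X b(1)
    by (metis diff_Suc_less gr_zeroI not_less_zero rangeI)
qed

lemma U_E_last: "U.E (z, u) k = z ^ k * u + (\<Sum>i = 1..k-1. t i * z ^ i)"
proof -
  have "(\<Sum>i<k. s i * z ^ (k - i)) = (\<Sum>i = 1..k-1. s i * z ^ (k - i))"
    by (rule sum.mono_neutral_right) (auto simp: s_def)
  also have "\<dots> = (\<Sum>i = 1..k-1. t i * z ^ i)"
    by (rule sum.reindex_bij_witness[of _ "\<lambda>i. k - i" "\<lambda>i. k - i"]) (auto simp: s_def)
  finally show ?thesis
    by (simp add: U.E_def scroll_param_sum)
qed

text \<open>The point \<open>U.E (z, u)\<close> lies on \<open>X\<close> and has a nonzero bottom entry, so it is recovered from its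
  \<open>V\<close>-coordinates. These are the inverse ratio of the rows, and the last coordinate.\<close>

lemma V_E_transition:
  assumes "z \<noteq> 0"
  shows "V.E (transition k t (z, u)) = U.E (z, u)"
proof -
  define x where "x = U.E (z, u)"
  obtain a where a: "a < k" "U.top_row x a \<noteq> 0"
    using U.top_E_nonzero x_def by blast
  define b where "b = k - Suc a"
  have b: "b < k" "k - Suc b = a" using a by (auto simp: b_def)
  have bot: "U.bot_row x a = z * U.top_row x a"
    using U.bot_E[OF a(1), of "(z, u)"] by (simp add: x_def)
  have "V.coords b x = (inverse z, x k + s k)"
    using a(2) assms by (simp add: V.coords_def V_top_row[OF b(1)] V_bot_row b(2) bot V.y_def field_simps)
  also have "\<dots> = transition k t (z, u)"
    by (simp add: transition_def x_def U_E_last s_def)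
  finally have "V.coords b x = transition k t (z, u)" .
  moreover have "V.top_row x b \<noteq> 0"
    using a(2) assms by (simp add: V_top_row[OF b(1)] b(2) bot)
  ultimately show ?thesis
    using V.E_coords[of x b] U.E_in_X V_X b(1) by (simp add: x_def)
qed

section \<open>The biholomorphic map onto the affine surface\<close>

definition embed :: "glue_pt \<Rightarrow> nat \<Rightarrow> complex" where
  "embed = case_sum U.E V.E"

lemma embed_simps [simp]: "embed (Inl p) = U.E p" "embed (Inr q) = V.E q"
  by (simp_all add: embed_def)

lemma embed_eq_imp_glued:
  assumes "U.E p = V.E q"
  shows "(Inl p, Inr q) \<in> glue_step k t"
proof -
  obtain z u where p: "p = (z, u)" by (cases p)
  obtain b where b: "b < k" "V.top_row (V.E q) b \<noteq> 0"
    using V.top_E_nonzero by blast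
  then have "U.bot_row (U.E p) (k - Suc b) \<noteq> 0"
    using V_top_row[OF b(1)] by (simp add: assms)
  then have z: "z \<noteq> 0"
    using U.bot_E[of "k - Suc b" p] b(1) p by auto
  then have "q = transition k t (z, u)"
    using V_E_transition[OF z, of u] assms p V.inj_E by (metis injD)
  then show ?thesis
    using z by (auto simp: glue_step_def p)
qed

text \<open>The embedding separates points of the glued surface: if \<open>(z, u)\<close> and \<open>(\<xi>, v)\<close> have the same image,
  its bottom row is nonzero, so \<open>z \<noteq> 0\<close> and the two points are identified by the gluing. A point of
  the surface is thus a fibre of \<open>embed\<close>, which gives the inverse map \<open>\<psi>\<close> directly.\<close>

lemma glue_rel_iff: "(a, b) \<in> glue_rel k t \<longleftrightarrow> embed a = embed b"
proof
  have glued: "embed a = embed b" if "(a, b) \<in> glue_step k t" for a b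
    using that V_E_transition by (auto simp: glue_step_def)
  assume "(a, b) \<in> glue_rel k t"
  then show "embed a = embed b"
    unfolding glue_rel_def
  proof (induction rule: rtrancl_induct)
    case (step b c)
    then show ?case using glued by fastforce
  qed simp
next
  assume eq: "embed a = embed b"
  have "a = b \<or> (a, b) \<in> glue_step k t \<union> (glue_step k t)\<inverse>"
    using eq embed_eq_imp_glued U.inj_E V.inj_E
    by (cases a; cases b) (auto dest: injD)
  then show "(a, b) \<in> glue_rel k t"
    unfolding glue_rel_def by auto
qed

lemma chart_U_eq: "chart_U k t p = embed -` {U.E p}"
  using glue_rel_iff by (auto simp: chart_U_def)

lemma chart_V_eq: "chart_V k t q = embed -` {V.E q}"
  using glue_rel_iff by (auto simp: chart_V_def)

lemma Z_points_eq: "Z_points k t = range (chart_U k t) \<union> range (chart_V k t)"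
proof
  show "Z_points k t \<subseteq> range (chart_U k t) \<union> range (chart_V k t)"
  proof
    fix C assume "C \<in> Z_points k t"
    then obtain a where "C = glue_rel k t `` {a}"
      by (auto simp: Z_points_def quotient_def)
    then show "C \<in> range (chart_U k t) \<union> range (chart_V k t)"
      by (cases a) (auto simp: chart_U_def chart_V_def)
  qed
qed (auto simp: Z_points_def quotient_def chart_U_def chart_V_def)

definition \<phi> :: "glue_pt set \<Rightarrow> nat \<Rightarrow> complex" where
  "\<phi> C = the_elem (embed ` C)"

definition \<psi> :: "(nat \<Rightarrow> complex) \<Rightarrow> glue_pt set" where
  "\<psi> x = embed -` {x}"

lemma \<phi>_chart [simp]: "\<phi> (chart_U k t p) = U.E p" "\<phi> (chart_V k t q) = V.E q"
proof -
  have "embed ` (embed -` {embed a}) = {embed a}" for a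
    by auto
  from this[of "Inl p"] this[of "Inr q"]
  show "\<phi> (chart_U k t p) = U.E p" "\<phi> (chart_V k t q) = V.E q"
    by (simp_all add: \<phi>_def chart_U_eq chart_V_eq)
qed

lemma \<psi>_chart [simp]: "\<psi> (U.E p) = chart_U k t p" "\<psi> (V.E q) = chart_V k t q"
  by (simp_all add: \<psi>_def chart_U_eq chart_V_eq)

lemma chart_in_Z [simp]: "chart_U k t p \<in> Z_points k t" "chart_V k t q \<in> Z_points k t"
  by (auto simp: Z_points_eq)

lemma E_in_X [simp]: "U.E p \<in> U.X" "V.E q \<in> U.X"
  by (auto simp: X_covered)

lemma topspace_Z: "topspace (Top (Z_deform k t)) = Z_points k t"
  by (simp add: Z_deform_def topspace_Z_deform_top)

lemma topspace_X: "topspace (Top (analytification (Suc k) U.X)) = U.X"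
  by (auto simp: analytification_def U.X_def)

lemma holomorphic_\<phi>: "holomorphic_map (Z_deform k t) (analytification (Suc k) U.X) \<phi>"
  unfolding holomorphic_map_def
proof (intro conjI allI impI)
  have pre: "chart_U k t -` {C \<in> Z_points k t. \<phi> C \<in> W} = U.E -` W"
    "chart_V k t -` {C \<in> Z_points k t. \<phi> C \<in> W} = V.E -` W" for W
    by auto
  show "continuous_map (Top (Z_deform k t)) (Top (analytification (Suc k) U.X)) \<phi>"
    unfolding continuous_map_def
  proof (intro conjI allI impI)
    show "\<phi> \<in> topspace (Top (Z_deform k t)) \<rightarrow> topspace (Top (analytification (Suc k) U.X))"
      unfolding topspace_X topspace_Z Z_points_eq by (intro funcsetI) (elim UnE rangeE; simp)
  next
    fix W assume "openin (Top (analytification (Suc k) U.X)) W"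
    then have "openin (subtopology (CN_top (Suc k)) U.X) W"
      by (simp add: analytification_def)
    then have "open (U.E -` W)" "open (V.E -` W)"
      using U.open_E_vimage_subtopology V.open_E_vimage_subtopology V_X by auto
    then show "openin (Top (Z_deform k t)) {C \<in> topspace (Top (Z_deform k t)). \<phi> C \<in> W}"
      unfolding topspace_Z using pre by (simp add: Z_deform_def openin_Z_deform_top)
  qed
  fix W f assume W: "openin (Top (analytification (Suc k) U.X)) W \<and> f \<in> Hol (analytification (Suc k) U.X) W"
  then have W': "openin (subtopology (CN_top (Suc k)) U.X) W"
    by (simp add: analytification_def)
  have "(\<lambda>p. f (U.E p)) \<in> hol_C2 (U.E -` W)"
    using U.Hol_E[OF W'] W by blast
  moreover have "(\<lambda>p. f (V.E p)) \<in> hol_C2 (V.E -` W)"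
    using V.Hol_E[of W f] W' W V_X by simp
  ultimately show "f \<circ> \<phi> \<in> Hol (Z_deform k t) {C \<in> topspace (Top (Z_deform k t)). \<phi> C \<in> W}"
    unfolding topspace_Z by (simp add: Z_deform_def pre o_def vimage_def)
qed

lemma holomorphic_\<psi>: "holomorphic_map (analytification (Suc k) U.X) (Z_deform k t) \<psi>"
  unfolding holomorphic_map_def
proof (intro conjI allI impI)
  have pre: "{x \<in> U.X. \<psi> x \<in> W} = U.E ` (chart_U k t -` W) \<union> V.E ` (chart_V k t -` W)" for W
    by (auto simp: X_covered)
  show "continuous_map (Top (analytification (Suc k) U.X)) (Top (Z_deform k t)) \<psi>"
    unfolding continuous_map_def
  proof (intro conjI allI impI)
    show "\<psi> \<in> topspace (Top (analytification (Suc k) U.X)) \<rightarrow> topspace (Top (Z_deform k t))"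
      using X_covered unfolding topspace_X topspace_Z by auto
  next
    fix W assume "openin (Top (Z_deform k t)) W"
    then have "open (chart_U k t -` W)" "open (chart_V k t -` W)"
      by (auto simp: Z_deform_def openin_Z_deform_top)
    then show "openin (Top (analytification (Suc k) U.X)) {x \<in> topspace (Top (analytification (Suc k) U.X)). \<psi> x \<in> W}"
      using U.openin_E_image V.openin_E_image V_X unfolding topspace_X pre
      by (simp add: analytification_def openin_Un)
  qed
  fix W f assume *: "openin (Top (Z_deform k t)) W \<and> f \<in> Hol (Z_deform k t) W"
  then have W: "open (chart_U k t -` W)" "open (chart_V k t -` W)"
    and f: "f \<circ> chart_U k t \<in> hol_C2 (chart_U k t -` W)" "f \<circ> chart_V k t \<in> hol_C2 (chart_V k t -` W)"
    by (auto simp: Z_deform_def openin_Z_deform_top)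
  have "\<exists>S g. openin (CN_top (Suc k)) S \<and> p \<in> S \<and> g \<in> hol_CN (Suc k) S \<and>
      (\<forall>x\<in>S \<inter> {x \<in> U.X. \<psi> x \<in> W}. (f \<circ> \<psi>) x = g x)" if p: "p \<in> {x \<in> U.X. \<psi> x \<in> W}" for p
  proof -
    consider q where "chart_U k t q \<in> W" "p = U.E q" | q where "chart_V k t q \<in> W" "p = V.E q"
      using p unfolding pre by auto
    then show ?thesis
    proof cases
      case 1
      then obtain S g where S: "openin (CN_top (Suc k)) S" "p \<in> S" "g \<in> hol_CN (Suc k) S"
        "\<forall>x\<in>S \<inter> U.X. \<exists>r\<in>chart_U k t -` W. x = U.E r \<and> g x = (f \<circ> chart_U k t) r"
        using U.local_extension[OF W(1) f(1), of q] by auto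
      then have "\<forall>x\<in>S \<inter> {x \<in> U.X. \<psi> x \<in> W}. (f \<circ> \<psi>) x = g x"
        by (metis (no_types, lifting) Int_iff \<psi>_chart(1) comp_apply mem_Collect_eq)
      then show ?thesis using S by blast
    next
      case 2
      then obtain S g where S: "openin (CN_top (Suc k)) S" "p \<in> S" "g \<in> hol_CN (Suc k) S"
        "\<forall>x\<in>S \<inter> U.X. \<exists>r\<in>chart_V k t -` W. x = V.E r \<and> g x = (f \<circ> chart_V k t) r"
        using V.local_extension[OF W(2) f(2), of q] V_X by auto
      then have "\<forall>x\<in>S \<inter> {x \<in> U.X. \<psi> x \<in> W}. (f \<circ> \<psi>) x = g x"
        by (metis (no_types, lifting) Int_iff \<psi>_chart(2) comp_apply mem_Collect_eq)
      then show ?thesis using S by blast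
    qed
  qed
  then show "f \<circ> \<psi> \<in> Hol (analytification (Suc k) U.X) {x \<in> topspace (Top (analytification (Suc k) U.X)). \<psi> x \<in> W}"
    unfolding topspace_X by (simp add: analytification_def)
qed

lemma biholomorphic_X: "biholomorphic (Z_deform k t) (analytification (Suc k) U.X)"
  unfolding biholomorphic_def
proof (intro exI conjI ballI)
  show "\<psi> (\<phi> x) = x" if "x \<in> topspace (Top (Z_deform k t))" for x
    using that unfolding topspace_Z Z_points_eq by (elim UnE rangeE) simp_all
  show "\<phi> (\<psi> x) = x" if "x \<in> topspace (Top (analytification (Suc k) U.X))" for x
    using that X_covered unfolding topspace_X by auto
qed (rule holomorphic_\<phi> holomorphic_\<psi>)+

section \<open>Irreducibility\<close>

text \<open>The part of \<open>X\<close> outside the chart \<open>U\<close> is the line \<open>\<xi> = 0\<close> of the chart \<open>V\<close>, and a continuous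
  function of \<open>\<xi>\<close> that is nonzero at \<open>0\<close> is nonzero at some \<open>\<xi> \<noteq> 0\<close>.\<close>

lemma nonzero_on_U:
  assumes f: "f \<in> polys (Suc k)" and x: "x \<in> U.X" "poly_val f x \<noteq> 0"
  shows "\<exists>p. poly_val f (U.E p) \<noteq> 0"
proof -
  consider p where "x = U.E p" | \<xi> v where "x = V.E (\<xi>, v)"
    using x(1) by (auto simp: X_covered)
  then show ?thesis
  proof cases
    case 2
    define D where "D = {s. poly_val f (V.E (s, v)) \<noteq> 0}"
    have "(\<lambda>s. poly_val f (V.E (s, v))) holomorphic_on UNIV"
      using f by (rule holomorphic_on_poly_val) (intro V.holomorphic_E holomorphic_intros)
    then have "open D"
      unfolding D_def using holomorphic_on_imp_continuous_on by (intro open_Collect_neq continuous_on_const) blast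
    moreover have "\<xi> \<in> D" using x 2 by (simp add: D_def)
    ultimately have "D \<noteq> {0}" "D \<noteq> {}"
      using not_open_singleton[of "0::complex"] by auto
    then obtain s where s: "s \<in> D" "s \<noteq> 0" by blast
    moreover obtain r where "V.E (s, v) = U.E r"
      using V_E_in_range_U[OF s(2), of v] by blast
    ultimately show ?thesis
      by (intro exI[of _ r]) (simp add: D_def)
  qed (use x in auto)
qed

text \<open>If \<open>X\<close> is the union of two proper algebraic subsets, each is contained in the zero set of a polynomial
  that is nonzero somewhere on \<open>X\<close>, hence on the chart \<open>U\<close>; there the two have a common
  point where neither vanishes.\<close>

lemma affine_variety_X: "affine_variety (Suc k) U.X"
  unfolding affine_variety_def
proof (intro conjI allI impI)
  show "algebraic_set (Suc k) U.X" by (rule U.algebraic_X)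
  show "U.X \<noteq> {}" using U.E_in_X by blast
  fix A B assume *: "algebraic_set (Suc k) A \<and> algebraic_set (Suc k) B \<and> U.X = A \<union> B"
  show "U.X = A \<or> U.X = B"
  proof (rule ccontr)
    assume no: "\<not> ?thesis"
    have "\<exists>f\<in>polys (Suc k). (\<forall>x\<in>A. poly_val f x = 0) \<and> (\<exists>p. poly_val f (U.E p) \<noteq> 0)"
      if A: "algebraic_set (Suc k) A" "A \<subset> U.X" for A
    proof -
      obtain F where F: "F \<subseteq> polys (Suc k)" "A = {x \<in> affine_space (Suc k). \<forall>f\<in>F. poly_val f x = 0}"
        using A(1) by (auto simp: algebraic_set_def)
      obtain x where x: "x \<in> U.X" "x \<notin> A" using A(2) by blast
      then have "x \<in> affine_space (Suc k)" by (simp add: U.X_def)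
      then obtain f where "f \<in> F" "poly_val f x \<noteq> 0" using x F by blast
      then show ?thesis
        using F x(1) nonzero_on_U by (intro bexI[of _ f]) auto
    qed
    note sep = this
    obtain f p where f: "f \<in> polys (Suc k)" "\<forall>x\<in>A. poly_val f x = 0" "poly_val f (U.E p) \<noteq> 0"
      using sep[of A] * no by blast
    obtain g q where g: "g \<in> polys (Suc k)" "\<forall>x\<in>B. poly_val g x = 0" "poly_val g (U.E q) \<noteq> 0"
      using sep[of B] * no by blast
    obtain r where "poly_val f (U.E r) \<noteq> 0" "poly_val g (U.E r) \<noteq> 0"
      using U.common_nonzero[OF f(1,3) g(1,3)] by blast
    then have "U.E r \<notin> A \<union> B" using f g by blast
    then show False using * E_in_X by metis
  qed
qed

lemma smooth_affine_X: "smooth_affine_variety (Suc k) U.X"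
  unfolding smooth_affine_variety_def
proof (intro conjI ballI)
  fix x assume x: "x \<in> U.X"
  then show "smooth_at (Suc k) U.X x"
    using row_nonzero[of x] U.smooth_at_pivot V.smooth_at_pivot V_X by auto
qed (rule affine_variety_X)

end

theorem theorem6p18:
  fixes k :: nat and t :: "nat \<Rightarrow> complex"
  assumes "k \<ge> 1"
    and nontrivial: "\<exists>i\<in>{1..k-1}. t i \<noteq> 0"
  shows "\<exists>N X. smooth_affine_variety N X \<and> biholomorphic (Z_deform k t) (analytification N X)"
proof -
  interpret deformation k t
    using nontrivial by unfold_locales
  show ?thesis
    using smooth_affine_X biholomorphic_X by blast
qed

end
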